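(* Let $R$ be a commutative ring. (1) Let $0\to A\to B\to C\to 0$ be a short exact sequence of $R$-modules. Then: (a) If $B$ is a finitely generated projective $R$-module, then $A\in\mathcal{FPR}(R)$ if and only if $C\in\mathcal{FPR}(R)$. (b) If $A,C\in\mathcal{FPR}(R)$, then $B\in\mathcal{FPR}(R)$. (c) If $A,B\in\mathcal{FPR}(R)$, then $C\in\mathcal{FPR}(R)$. (d) If $B,C\in\mathcal{FPR}(R)$, then $A\in\mathcal{FPR}(R)$. (2) Let $0\to K\to P_n\to P_{n-1}\to\cdots\to P_1\to P_0\to M\to 0$ be an exact sequence of $R$-modules, where each $P_i\in\mathcal{FPR}(R)$. Then $M\in\mathcal{FPR}(R)$ if and only if $K\in\mathcal{FPR}(R)$.
   Context: All rings are commutative with identity. For a ring $R$, $\mathcal{FPR}(R)$ is the class of $R$-modules $M$ admitting an exact sequence $0\to Q_k\to\cdots\to Q_1\to Q_0\to M\to 0$ (some $k\ge 0$) with every $Q_i$ a finitely generated projective $R$-module. *)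

theory Defs
  imports "HOL-Algebra.Module" "HOL-Algebra.AbelCoset"
begin

section \<open>Linear maps, finite generation, projectivity\<close>

definition mod_hom ::
    "('a, 'r) ring_scheme \<Rightarrow> ('a, 'b, 'm) module_scheme \<Rightarrow> ('a, 'c, 'n) module_scheme \<Rightarrow> ('b \<Rightarrow> 'c) set"
  where "mod_hom R M N =
    {f \<in> carrier M \<rightarrow> carrier N.
       (\<forall>x\<in>carrier M. \<forall>y\<in>carrier M. f (x \<oplus>\<^bsub>M\<^esub> y) = f x \<oplus>\<^bsub>N\<^esub> f y) \<and>
       (\<forall>a\<in>carrier R. \<forall>x\<in>carrier M. f (a \<odot>\<^bsub>M\<^esub> x) = a \<odot>\<^bsub>N\<^esub> f x)}"

definition fin_gen_module :: "('a, 'r) ring_scheme \<Rightarrow> ('a, 'b, 'm) module_scheme \<Rightarrow> bool"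
  where "fin_gen_module R M \<longleftrightarrow> module R M \<and>
    (\<exists>S. finite S \<and> S \<subseteq> carrier M \<and>
       (\<forall>x\<in>carrier M. \<exists>c \<in> S \<rightarrow> carrier R. x = (\<Oplus>\<^bsub>M\<^esub>s\<in>S. c s \<odot>\<^bsub>M\<^esub> s)))"

text \<open>
  Projectivity is the lifting property against surjective linear maps. A HOL definition
  cannot quantify over the carrier types of the test modules, so these are fixed to be
  \<open>'b \<Rightarrow> 'a\<close>, where \<open>'b\<close> is the carrier type of \<open>P\<close>. This type holds both the free module on
  \<open>carrier P\<close> and a copy of \<open>P\<close> itself, and therefore the property for these test modules implies
  the property for test modules over arbitrary types: see \<open>projective_module_lift\<close> below.
\<close>

definition projective_module :: "('a, 'r) ring_scheme \<Rightarrow> ('a, 'b, 'm) module_scheme \<Rightarrow> bool"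
  where "projective_module R P \<longleftrightarrow> module R P \<and>
    (\<forall>(N :: ('a, 'b \<Rightarrow> 'a) module) (N' :: ('a, 'b \<Rightarrow> 'a) module) g f.
       module R N \<and> module R N' \<and> g \<in> mod_hom R N N' \<and> g ` carrier N = carrier N' \<and>
       f \<in> mod_hom R P N' \<longrightarrow>
       (\<exists>h \<in> mod_hom R P N. \<forall>x\<in>carrier P. g (h x) = f x))"

lemma mod_homD:
  assumes "f \<in> mod_hom R M N"
  shows "x \<in> carrier M \<Longrightarrow> f x \<in> carrier N"
    and "x \<in> carrier M \<Longrightarrow> y \<in> carrier M \<Longrightarrow> f (x \<oplus>\<^bsub>M\<^esub> y) = f x \<oplus>\<^bsub>N\<^esub> f y"
    and "a \<in> carrier R \<Longrightarrow> x \<in> carrier M \<Longrightarrow> f (a \<odot>\<^bsub>M\<^esub> x) = a \<odot>\<^bsub>N\<^esub> f x"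
  using assms by (auto simp: mod_hom_def)

lemma mod_homI:
  assumes "\<And>x. x \<in> carrier M \<Longrightarrow> f x \<in> carrier N"
    and "\<And>x y. x \<in> carrier M \<Longrightarrow> y \<in> carrier M \<Longrightarrow> f (x \<oplus>\<^bsub>M\<^esub> y) = f x \<oplus>\<^bsub>N\<^esub> f y"
    and "\<And>a x. a \<in> carrier R \<Longrightarrow> x \<in> carrier M \<Longrightarrow> f (a \<odot>\<^bsub>M\<^esub> x) = a \<odot>\<^bsub>N\<^esub> f x"
  shows "f \<in> mod_hom R M N"
  using assms by (auto simp: mod_hom_def)

lemma mod_hom_comp:
  assumes "f \<in> mod_hom R M N" "g \<in> mod_hom R N L"
  shows "(\<lambda>x. g (f x)) \<in> mod_hom R M L"
  using assms by (auto simp: mod_hom_def Pi_iff)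

lemma mod_hom_zero:
  assumes "f \<in> mod_hom R M N" "module R M" "module R N"
  shows "f \<zero>\<^bsub>M\<^esub> = \<zero>\<^bsub>N\<^esub>"
proof -
  interpret M: module R M by fact
  interpret N: module R N by fact
  have "f \<zero>\<^bsub>M\<^esub> \<oplus>\<^bsub>N\<^esub> f \<zero>\<^bsub>M\<^esub> = f (\<zero>\<^bsub>M\<^esub> \<oplus>\<^bsub>M\<^esub> \<zero>\<^bsub>M\<^esub>)"
    using mod_homD(2)[OF assms(1)] by (metis M.M.zero_closed)
  hence "f \<zero>\<^bsub>M\<^esub> \<oplus>\<^bsub>N\<^esub> f \<zero>\<^bsub>M\<^esub> = f \<zero>\<^bsub>M\<^esub>" by simp
  thus ?thesis
    using mod_homD(1)[OF assms(1)] N.M.add.r_cancel_one' by (metis M.M.zero_closed)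
qed

lemma mod_hom_finsum:
  assumes "f \<in> mod_hom R M N" "module R M" "module R N" "finite S" "v \<in> S \<rightarrow> carrier M"
  shows "f (\<Oplus>\<^bsub>M\<^esub>s\<in>S. v s) = (\<Oplus>\<^bsub>N\<^esub>s\<in>S. f (v s))"
proof -
  interpret M: module R M by fact
  interpret N: module R N by fact
  show ?thesis using assms(4,5)
  proof (induction S rule: finite_induct)
    case empty
    then show ?case using mod_hom_zero[OF assms(1-3)] by simp
  next
    case (insert x S)
    have v: "v \<in> S \<rightarrow> carrier M" "v x \<in> carrier M" using insert.prems by auto
    have fv: "(\<lambda>s. f (v s)) \<in> S \<rightarrow> carrier N" "f (v x) \<in> carrier N"
      using v mod_homD(1)[OF assms(1)] by auto
    show ?case
      using insert v fv by (simp add: mod_homD(2)[OF assms(1)])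
  qed
qed

lemma bij_module_copy:
  fixes N :: "('a, 'b, 'm) module_scheme" and \<phi> :: "'b \<Rightarrow> 'c"
  assumes N: "module R N" and inj: "inj_on \<phi> (carrier N)"
  obtains T :: "('a, 'c) module" and \<psi>
  where "module R T" "carrier T = \<phi> ` carrier N" "\<phi> \<in> mod_hom R N T" "\<psi> \<in> mod_hom R T N"
    "\<And>x. x \<in> carrier N \<Longrightarrow> \<psi> (\<phi> x) = x" "\<And>y. y \<in> carrier T \<Longrightarrow> \<phi> (\<psi> y) = y"
    "\<zero>\<^bsub>T\<^esub> = \<phi> \<zero>\<^bsub>N\<^esub>"
proof -
  interpret N: module R N by fact
  define \<psi> where "\<psi> = inv_into (carrier N) \<phi>"
  have inv[simp]: "\<psi> (\<phi> x) = x" if "x \<in> carrier N" for x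
    using inj that by (simp add: \<psi>_def)
  define T :: "('a, 'c) module" where
    "T = \<lparr>carrier = \<phi> ` carrier N, mult = undefined, one = undefined, zero = \<phi> \<zero>\<^bsub>N\<^esub>,
          add = (\<lambda>x y. \<phi> (\<psi> x \<oplus>\<^bsub>N\<^esub> \<psi> y)), smult = (\<lambda>a x. \<phi> (a \<odot>\<^bsub>N\<^esub> \<psi> x))\<rparr>"
  have T[simp]: "carrier T = \<phi> ` carrier N" "\<zero>\<^bsub>T\<^esub> = \<phi> \<zero>\<^bsub>N\<^esub>"
    "x \<oplus>\<^bsub>T\<^esub> y = \<phi> (\<psi> x \<oplus>\<^bsub>N\<^esub> \<psi> y)" "a \<odot>\<^bsub>T\<^esub> x = \<phi> (a \<odot>\<^bsub>N\<^esub> \<psi> x)" for x y a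
    by (simp_all add: T_def)
  have "abelian_group T"
  proof (rule abelian_groupI)
    fix x assume "x \<in> carrier T"
    then obtain u where "u \<in> carrier N" "x = \<phi> u" by auto
    thus "\<exists>y\<in>carrier T. y \<oplus>\<^bsub>T\<^esub> x = \<zero>\<^bsub>T\<^esub>"
      by (intro bexI[of _ "\<phi> (\<ominus>\<^bsub>N\<^esub> u)"]) (auto simp: N.M.l_neg)
  qed (auto simp: N.M.a_ac)
  hence mod: "module R T"
    by (intro moduleI)
       (auto simp: N.smult_l_distr N.smult_r_distr N.smult_assoc1 N.R.is_cring)
  have "\<phi> \<in> mod_hom R N T" "\<psi> \<in> mod_hom R T N"
    by (auto intro!: mod_homI)
  thus thesis using mod by (intro that[of T \<psi>]) auto
qed

subsection \<open>Projectivity does not depend on the type of the test modules\<close>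

definition free_mod :: "('a, 'r) ring_scheme \<Rightarrow> 'b set \<Rightarrow> ('a, 'b \<Rightarrow> 'a) module"
  where "free_mod R X =
    \<lparr>carrier = {c. (\<forall>x. c x \<in> carrier R) \<and> (\<forall>x. x \<notin> X \<longrightarrow> c x = \<zero>\<^bsub>R\<^esub>) \<and> finite {x. c x \<noteq> \<zero>\<^bsub>R\<^esub>}},
     mult = undefined, one = undefined, zero = (\<lambda>_. \<zero>\<^bsub>R\<^esub>),
     add = (\<lambda>c c' x. c x \<oplus>\<^bsub>R\<^esub> c' x), smult = (\<lambda>a c x. a \<otimes>\<^bsub>R\<^esub> c x)\<rparr>"

lemma free_mod_simps:
  "c \<in> carrier (free_mod R X) \<longleftrightarrow>
     (\<forall>x. c x \<in> carrier R) \<and> (\<forall>x. x \<notin> X \<longrightarrow> c x = \<zero>\<^bsub>R\<^esub>) \<and> finite {x. c x \<noteq> \<zero>\<^bsub>R\<^esub>}"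
  "\<zero>\<^bsub>free_mod R X\<^esub> = (\<lambda>_. \<zero>\<^bsub>R\<^esub>)"
  "c \<oplus>\<^bsub>free_mod R X\<^esub> c' = (\<lambda>x. c x \<oplus>\<^bsub>R\<^esub> c' x)"
  "a \<odot>\<^bsub>free_mod R X\<^esub> c = (\<lambda>x. a \<otimes>\<^bsub>R\<^esub> c x)"
  by (auto simp: free_mod_def)

lemma free_mod_module:
  fixes R :: "('a, 'r) ring_scheme" and X :: "'b set"
  assumes "cring R"
  shows "module R (free_mod R X)"
proof -
  interpret R: cring R by fact
  have fin_add: "finite {x. c x \<oplus>\<^bsub>R\<^esub> c' x \<noteq> \<zero>\<^bsub>R\<^esub>}"
    if "finite {x. c x \<noteq> \<zero>\<^bsub>R\<^esub>}" "finite {x. c' x \<noteq> \<zero>\<^bsub>R\<^esub>}" for c c' :: "'b \<Rightarrow> 'a"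
    by (rule finite_subset[OF _ finite_UnI[OF that]]) auto
  have fin_smult: "finite {x. a \<otimes>\<^bsub>R\<^esub> c x \<noteq> \<zero>\<^bsub>R\<^esub>}"
    if "finite {x. c x \<noteq> \<zero>\<^bsub>R\<^esub>}" "a \<in> carrier R" for a and c :: "'b \<Rightarrow> 'a"
    by (rule finite_subset[OF _ that(1)]) (use that in auto)
  have "abelian_group (free_mod R X)"
  proof (rule abelian_groupI)
    fix c assume c: "c \<in> carrier (free_mod R X)"
    have "finite {x. \<ominus>\<^bsub>R\<^esub> c x \<noteq> \<zero>\<^bsub>R\<^esub>}"
      by (rule finite_subset[of _ "{x. c x \<noteq> \<zero>\<^bsub>R\<^esub>}"]) (use c in \<open>auto simp: free_mod_simps\<close>)
    thus "\<exists>c'\<in>carrier (free_mod R X). c' \<oplus>\<^bsub>free_mod R X\<^esub> c = \<zero>\<^bsub>free_mod R X\<^esub>"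
      using c by (intro bexI[of _ "\<lambda>x. \<ominus>\<^bsub>R\<^esub> c x"]) (auto simp: free_mod_simps R.l_neg)
  qed (auto simp: free_mod_simps R.a_ac intro!: fin_add)
  thus ?thesis
    by (intro moduleI)
       (auto simp: free_mod_simps R.is_cring R.l_distr R.r_distr R.m_assoc fin_smult)
qed

definition lin_ext :: "('a, 'r) ring_scheme \<Rightarrow> ('a, 'c, 'm) module_scheme \<Rightarrow> ('b \<Rightarrow> 'c) \<Rightarrow> ('b \<Rightarrow> 'a) \<Rightarrow> 'c"
  where "lin_ext R N v c = (\<Oplus>\<^bsub>N\<^esub>x\<in>{x. c x \<noteq> \<zero>\<^bsub>R\<^esub>}. c x \<odot>\<^bsub>N\<^esub> v x)"

lemma lin_ext_superset:
  assumes "module R N" "\<And>x. x \<in> X \<Longrightarrow> v x \<in> carrier N" "c \<in> carrier (free_mod R X)"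
    "finite S" "{x. c x \<noteq> \<zero>\<^bsub>R\<^esub>} \<subseteq> S" "S \<subseteq> X"
  shows "lin_ext R N v c = (\<Oplus>\<^bsub>N\<^esub>x\<in>S. c x \<odot>\<^bsub>N\<^esub> v x)"
proof -
  interpret N: module R N by fact
  have c: "c x \<in> carrier R" for x using assms(3) by (simp add: free_mod_simps)
  show ?thesis unfolding lin_ext_def
    by (rule N.M.add.finprod_mono_neutral_cong_left)
       (use assms c in \<open>auto simp: subset_iff\<close>)
qed

lemma supp_subset:
  "c \<in> carrier (free_mod R X) \<Longrightarrow> {x. c x \<noteq> \<zero>\<^bsub>R\<^esub>} \<subseteq> X"
  "c \<in> carrier (free_mod R X) \<Longrightarrow> finite {x. c x \<noteq> \<zero>\<^bsub>R\<^esub>}"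
  by (auto simp: free_mod_simps)

lemma lin_ext_hom:
  assumes N: "module R N" and v: "\<And>x. x \<in> X \<Longrightarrow> v x \<in> carrier N"
  shows "lin_ext R N v \<in> mod_hom R (free_mod R X) N"
proof -
  interpret N: module R N by fact
  interpret F: module R "free_mod R X" by (rule free_mod_module) (rule N.R.is_cring)
  let ?s = "\<lambda>c :: _ \<Rightarrow> _. {x. c x \<noteq> \<zero>\<^bsub>R\<^esub>}"
  have cl: "c x \<in> carrier R" if "c \<in> carrier (free_mod R X)" for c x
    using that by (simp add: free_mod_simps)
  show ?thesis
  proof (rule mod_homI)
    fix c assume c: "c \<in> carrier (free_mod R X)"
    show "lin_ext R N v c \<in> carrier N"
      unfolding lin_ext_def using supp_subset(1)[OF c] cl[OF c] v
      by (intro N.M.finsum_closed) auto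
  next
    fix c c' assume c: "c \<in> carrier (free_mod R X)" and c': "c' \<in> carrier (free_mod R X)"
    let ?S = "?s c \<union> ?s c'"
    have S: "finite ?S" "?S \<subseteq> X" using supp_subset[OF c] supp_subset[OF c'] by auto
    have sub: "?s (c \<oplus>\<^bsub>free_mod R X\<^esub> c') \<subseteq> ?S"
      by (auto simp: free_mod_simps)
    have "lin_ext R N v (c \<oplus>\<^bsub>free_mod R X\<^esub> c') =
        (\<Oplus>\<^bsub>N\<^esub>x\<in>?S. (c \<oplus>\<^bsub>free_mod R X\<^esub> c') x \<odot>\<^bsub>N\<^esub> v x)"
      by (rule lin_ext_superset[OF N v _ S(1) sub S(2)]) (use c c' in auto)
    also have "\<dots> = (\<Oplus>\<^bsub>N\<^esub>x\<in>?S. c x \<odot>\<^bsub>N\<^esub> v x \<oplus>\<^bsub>N\<^esub> c' x \<odot>\<^bsub>N\<^esub> v x)"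
      using S v cl[OF c] cl[OF c']
      by (intro N.M.finsum_cong') (auto simp: free_mod_simps N.smult_l_distr subset_iff)
    also have "\<dots> = (\<Oplus>\<^bsub>N\<^esub>x\<in>?S. c x \<odot>\<^bsub>N\<^esub> v x) \<oplus>\<^bsub>N\<^esub> (\<Oplus>\<^bsub>N\<^esub>x\<in>?S. c' x \<odot>\<^bsub>N\<^esub> v x)"
      using S v cl[OF c] cl[OF c']
      by (intro N.M.finsum_addf) (auto simp: subset_iff)
    also have "(\<Oplus>\<^bsub>N\<^esub>x\<in>?S. c x \<odot>\<^bsub>N\<^esub> v x) = lin_ext R N v c"
      by (rule lin_ext_superset[OF N v c S(1) _ S(2), symmetric]) auto
    also have "(\<Oplus>\<^bsub>N\<^esub>x\<in>?S. c' x \<odot>\<^bsub>N\<^esub> v x) = lin_ext R N v c'"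
      by (rule lin_ext_superset[OF N v c' S(1) _ S(2), symmetric]) auto
    finally show "lin_ext R N v (c \<oplus>\<^bsub>free_mod R X\<^esub> c') = lin_ext R N v c \<oplus>\<^bsub>N\<^esub> lin_ext R N v c'" .
  next
    fix a c assume a: "a \<in> carrier R" and c: "c \<in> carrier (free_mod R X)"
    have sub: "?s (a \<odot>\<^bsub>free_mod R X\<^esub> c) \<subseteq> ?s c"
      using a by (auto simp: free_mod_simps)
    have "lin_ext R N v (a \<odot>\<^bsub>free_mod R X\<^esub> c) =
        (\<Oplus>\<^bsub>N\<^esub>x\<in>?s c. (a \<odot>\<^bsub>free_mod R X\<^esub> c) x \<odot>\<^bsub>N\<^esub> v x)"
      by (rule lin_ext_superset[OF N v _ supp_subset(2)[OF c] sub supp_subset(1)[OF c]])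
         (use a c in auto)
    also have "\<dots> = (\<Oplus>\<^bsub>N\<^esub>x\<in>?s c. a \<odot>\<^bsub>N\<^esub> (c x \<odot>\<^bsub>N\<^esub> v x))"
      using a supp_subset(1)[OF c] v cl[OF c]
      by (intro N.M.finsum_cong') (auto simp: free_mod_simps N.smult_assoc1 subset_iff)
    also have "\<dots> = a \<odot>\<^bsub>N\<^esub> lin_ext R N v c"
      unfolding lin_ext_def using a supp_subset[OF c] v cl[OF c]
      by (intro N.finsum_smult_ldistr[symmetric]) (auto simp: subset_iff)
    finally show "lin_ext R N v (a \<odot>\<^bsub>free_mod R X\<^esub> c) = a \<odot>\<^bsub>N\<^esub> lin_ext R N v c" .
  qed
qed

lemma hom_lin_ext:
  assumes g: "g \<in> mod_hom R N L" and N: "module R N" and L: "module R L"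
    and v: "\<And>x. x \<in> X \<Longrightarrow> v x \<in> carrier N" and c: "c \<in> carrier (free_mod R X)"
  shows "g (lin_ext R N v c) = lin_ext R L (\<lambda>x. g (v x)) c"
proof -
  interpret N: module R N by fact
  interpret L: module R L by fact
  have cl: "c x \<in> carrier R" for x using c by (simp add: free_mod_simps)
  have "g (lin_ext R N v c) = (\<Oplus>\<^bsub>L\<^esub>x\<in>{x. c x \<noteq> \<zero>\<^bsub>R\<^esub>}. g (c x \<odot>\<^bsub>N\<^esub> v x))"
    unfolding lin_ext_def using supp_subset[OF c] cl v
    by (intro mod_hom_finsum[OF g N L]) auto
  also have "\<dots> = lin_ext R L (\<lambda>x. g (v x)) c"
    unfolding lin_ext_def using supp_subset[OF c] cl v mod_homD[OF g]
    by (intro L.M.finsum_cong') (auto simp: subset_iff)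
  finally show ?thesis .
qed

lemma lin_ext_cong:
  assumes "module R N" "\<And>x. x \<in> X \<Longrightarrow> v x = w x" "\<And>x. x \<in> X \<Longrightarrow> w x \<in> carrier N"
    "c \<in> carrier (free_mod R X)"
  shows "lin_ext R N v c = lin_ext R N w c"
proof -
  interpret N: module R N by fact
  show ?thesis unfolding lin_ext_def
  proof (intro N.M.finsum_cong')
    fix x assume "x \<in> {x. c x \<noteq> \<zero>\<^bsub>R\<^esub>}"
    hence "x \<in> X" using supp_subset(1)[OF assms(4)] by blast
    thus "c x \<odot>\<^bsub>N\<^esub> v x = c x \<odot>\<^bsub>N\<^esub> w x" by (simp only: assms(2))
  next
    show "(\<lambda>x. c x \<odot>\<^bsub>N\<^esub> w x) \<in> {x. c x \<noteq> \<zero>\<^bsub>R\<^esub>} \<rightarrow> carrier N"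
      using assms(3) supp_subset(1)[OF assms(4)] assms(4) by (auto simp: free_mod_simps)
  qed simp
qed

theorem projective_module_lift:
  fixes R :: "('a, 'r) ring_scheme" and P :: "('a, 'b, 'm) module_scheme"
    and N :: "('a, 'c, 'n) module_scheme" and N' :: "('a, 'd, 'k) module_scheme"
  assumes P: "projective_module R P"
    and N: "module R N" and N': "module R N'"
    and g: "g \<in> mod_hom R N N'" and surj: "g ` carrier N = carrier N'"
    and f: "f \<in> mod_hom R P N'"
  shows "\<exists>h \<in> mod_hom R P N. \<forall>x\<in>carrier P. g (h x) = f x"
proof -
  have modP: "module R P" using P by (simp add: projective_module_def)
  interpret P: module R P by fact
  let ?F = "free_mod R (carrier P)"
  have F: "module R ?F" by (rule free_mod_module) (rule P.R.is_cring)
  define \<delta> where "\<delta> = (\<lambda>x y :: 'b. if y = x then \<one>\<^bsub>R\<^esub> else \<zero>\<^bsub>R\<^esub>)"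
  have \<delta>F: "\<delta> x \<in> carrier ?F" if "x \<in> carrier P" for x
    using that by (auto simp: free_mod_simps \<delta>_def)
  have inj: "inj_on \<delta> (carrier P)"
  proof (cases "\<one>\<^bsub>R\<^esub> = \<zero>\<^bsub>R\<^esub>")
    case True
    have "x = \<zero>\<^bsub>P\<^esub>" if "x \<in> carrier P" for x
      using P.smult_one[OF that] P.smult_l_null[OF that] True by metis
    thus ?thesis by (auto simp: inj_on_def)
  next
    case False
    show ?thesis
    proof (rule inj_onI)
      fix x y assume "\<delta> x = \<delta> y"
      hence "\<delta> x x = \<delta> y x" by simp
      thus "x = y" using False by (auto simp: \<delta>_def split: if_splits)
    qed
  qed
  obtain P' :: "('a, 'b \<Rightarrow> 'a) module" and \<psi> where P': "module R P'" "carrier P' = \<delta> ` carrier P"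
    "\<delta> \<in> mod_hom R P P'" "\<psi> \<in> mod_hom R P' P" "\<And>x. x \<in> carrier P \<Longrightarrow> \<psi> (\<delta> x) = x"
    using bij_module_copy[OF modP inj] by metis
  let ?eps = "lin_ext R P (\<lambda>x. x)"
  have eps: "?eps \<in> mod_hom R ?F P" by (rule lin_ext_hom[OF modP])
  have eps_delta: "?eps (\<delta> x) = x" if x: "x \<in> carrier P" for x
  proof -
    have "?eps (\<delta> x) = (\<Oplus>\<^bsub>P\<^esub>y\<in>{x}. \<delta> x y \<odot>\<^bsub>P\<^esub> y)"
      by (rule lin_ext_superset[OF modP _ \<delta>F[OF x]]) (use x in \<open>auto simp: \<delta>_def split: if_splits\<close>)
    also have "\<dots> = \<delta> x x \<odot>\<^bsub>P\<^esub> x" using x by (simp add: \<delta>_def)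
    finally show ?thesis using x by (simp add: \<delta>_def)
  qed
  have "(\<lambda>c. \<delta> (?eps c)) \<in> mod_hom R ?F P'" by (rule mod_hom_comp[OF eps P'(3)])
  moreover have "(\<lambda>c. \<delta> (?eps c)) ` carrier ?F = carrier P'"
  proof
    show "(\<lambda>c. \<delta> (?eps c)) ` carrier ?F \<subseteq> carrier P'"
      using mod_homD(1)[OF eps] P'(2) by auto
    show "carrier P' \<subseteq> (\<lambda>c. \<delta> (?eps c)) ` carrier ?F"
    proof
      fix z assume "z \<in> carrier P'"
      then obtain x where x: "x \<in> carrier P" "z = \<delta> x" using P'(2) by auto
      show "z \<in> (\<lambda>c. \<delta> (?eps c)) ` carrier ?F"
        by (rule image_eqI[where x = "\<delta> x"]) (use x eps_delta \<delta>F in auto)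
    qed
  qed
  ultimately have "\<exists>s \<in> mod_hom R P ?F. \<forall>x\<in>carrier P. \<delta> (?eps (s x)) = \<delta> x"
    using P[unfolded projective_module_def, THEN conjunct2, rule_format,
        of ?F P' "\<lambda>c. \<delta> (?eps c)" \<delta>] F P'(1,3) by simp
  then obtain s where s: "s \<in> mod_hom R P ?F"
    "\<And>x. x \<in> carrier P \<Longrightarrow> \<delta> (?eps (s x)) = \<delta> x"
    by blast
  have split: "?eps (s x) = x" if "x \<in> carrier P" for x
    by (rule inj_onD[OF inj s(2)[OF that] mod_homD(1)[OF eps mod_homD(1)[OF s(1) that]] that])
  have "\<forall>x\<in>carrier P. \<exists>n\<in>carrier N. g n = f x"
    using mod_homD(1)[OF f] surj by (metis imageE)
  then obtain n where n: "\<And>x. x \<in> carrier P \<Longrightarrow> n x \<in> carrier N"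
      "\<And>x. x \<in> carrier P \<Longrightarrow> g (n x) = f x"
    by metis
  define h where "h = (\<lambda>x. lin_ext R N n (s x))"
  have "h \<in> mod_hom R P N"
    unfolding h_def by (rule mod_hom_comp[OF s(1) lin_ext_hom[OF N n(1)]])
  moreover have "g (h x) = f x" if x: "x \<in> carrier P" for x
  proof -
    note sx = mod_homD(1)[OF s(1) x]
    have "g (h x) = lin_ext R N' (\<lambda>x. g (n x)) (s x)"
      unfolding h_def by (rule hom_lin_ext[OF g N N' n(1) sx])
    also have "\<dots> = lin_ext R N' (\<lambda>x. f x) (s x)"
      by (rule lin_ext_cong[OF N' _ _ sx]) (use n mod_homD(1)[OF f] in auto)
    also have "\<dots> = f (?eps (s x))"
      by (rule hom_lin_ext[OF f modP N' _ sx, symmetric])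
    finally show ?thesis using split[OF x] by simp
  qed
  ultimately show ?thesis by blast
qed


section \<open>Exact sequences\<close>

definition short_exact ::
    "('a, 'r) ring_scheme \<Rightarrow> ('a, 'b, 'm) module_scheme \<Rightarrow> ('b \<Rightarrow> 'c) \<Rightarrow> ('a, 'c, 'n) module_scheme
     \<Rightarrow> ('c \<Rightarrow> 'd) \<Rightarrow> ('a, 'd, 'k) module_scheme \<Rightarrow> bool"
  where "short_exact R A f B g C \<longleftrightarrow>
    module R A \<and> module R B \<and> module R C \<and> f \<in> mod_hom R A B \<and> g \<in> mod_hom R B C \<and>
    a_kernel A B f = {\<zero>\<^bsub>A\<^esub>} \<and> f ` carrier A = a_kernel B C g \<and> g ` carrier B = carrier C"

text \<open>
  In a sequence \<open>Q n \<rightarrow> \<dots> \<rightarrow> Q 1 \<rightarrow> Q 0 \<rightarrow> M\<close> the differentials are \<open>d j : Q (j + 1) \<rightarrow> Q j\<close> and the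
  augmentation is \<open>e : Q 0 \<rightarrow> M\<close>. \<open>out_kernel Q d e M j\<close> is the kernel of the map leaving \<open>Q j\<close>.
\<close>

primrec out_kernel ::
    "(nat \<Rightarrow> ('a, 'b, 'm) module_scheme) \<Rightarrow> (nat \<Rightarrow> 'b \<Rightarrow> 'b) \<Rightarrow> ('b \<Rightarrow> 'c) \<Rightarrow> ('a, 'c, 'n) module_scheme
     \<Rightarrow> nat \<Rightarrow> 'b set"
  where
    "out_kernel Q d e M 0 = a_kernel (Q 0) M e"
  | "out_kernel Q d e M (Suc j) = a_kernel (Q (Suc j)) (Q j) (d j)"

text \<open>Exactness of \<open>Q n \<rightarrow> \<dots> \<rightarrow> Q 0 \<rightarrow> M \<rightarrow> 0\<close>, with no condition on the kernel at \<open>Q n\<close>.\<close>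

definition right_exact_seq ::
    "('a, 'r) ring_scheme \<Rightarrow> nat \<Rightarrow> (nat \<Rightarrow> ('a, 'b, 'm) module_scheme) \<Rightarrow> (nat \<Rightarrow> 'b \<Rightarrow> 'b)
     \<Rightarrow> ('b \<Rightarrow> 'c) \<Rightarrow> ('a, 'c, 'n) module_scheme \<Rightarrow> bool"
  where "right_exact_seq R n Q d e M \<longleftrightarrow>
    module R M \<and> (\<forall>j\<le>n. module R (Q j)) \<and>
    e \<in> mod_hom R (Q 0) M \<and> (\<forall>j<n. d j \<in> mod_hom R (Q (Suc j)) (Q j)) \<and>
    e ` carrier (Q 0) = carrier M \<and>
    (\<forall>j<n. d j ` carrier (Q (Suc j)) = out_kernel Q d e M j)"

text \<open>Exactness of \<open>0 \<rightarrow> K \<rightarrow> Q n \<rightarrow> \<dots> \<rightarrow> Q 0 \<rightarrow> M \<rightarrow> 0\<close>.\<close>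

definition long_exact ::
    "('a, 'r) ring_scheme \<Rightarrow> ('a, 'k, 'l) module_scheme \<Rightarrow> ('k \<Rightarrow> 'b) \<Rightarrow> nat
     \<Rightarrow> (nat \<Rightarrow> ('a, 'b, 'm) module_scheme) \<Rightarrow> (nat \<Rightarrow> 'b \<Rightarrow> 'b)
     \<Rightarrow> ('b \<Rightarrow> 'c) \<Rightarrow> ('a, 'c, 'n) module_scheme \<Rightarrow> bool"
  where "long_exact R K i n Q d e M \<longleftrightarrow>
    right_exact_seq R n Q d e M \<and> module R K \<and> i \<in> mod_hom R K (Q n) \<and>
    a_kernel K (Q n) i = {\<zero>\<^bsub>K\<^esub>} \<and> i ` carrier K = out_kernel Q d e M n"


section \<open>Modules with a finite resolution by finitely generated projectives\<close>

definition fgp_resolution ::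
    "('a, 'r) ring_scheme \<Rightarrow> nat \<Rightarrow> (nat \<Rightarrow> ('a, 'b, 'm) module_scheme) \<Rightarrow> (nat \<Rightarrow> 'b \<Rightarrow> 'b)
     \<Rightarrow> ('b \<Rightarrow> 'c) \<Rightarrow> ('a, 'c, 'n) module_scheme \<Rightarrow> bool"
  where "fgp_resolution R k Q d e M \<longleftrightarrow>
    right_exact_seq R k Q d e M \<and> out_kernel Q d e M k = {\<zero>\<^bsub>Q k\<^esub>} \<and>
    (\<forall>j\<le>k. fin_gen_module R (Q j) \<and> projective_module R (Q j))"

text \<open>
  The modules in the resolution have carrier type \<open>nat \<Rightarrow> 'a\<close>. Every finitely generated module
  over \<open>R\<close> has an isomorphic copy there (represent an element by a tuple of coefficients), so
  resolutions over any other type give the same class: see \<open>FPR_of_fgp_resolution\<close> below.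
\<close>

definition FPR :: "('a, 'r) ring_scheme \<Rightarrow> ('a, 'b, 'm) module_scheme \<Rightarrow> bool"
  where "FPR R M \<longleftrightarrow>
    (\<exists>k (Q :: nat \<Rightarrow> ('a, nat \<Rightarrow> 'a) module) d e. fgp_resolution R k Q d e M)"

subsection \<open>The class does not depend on the type of the resolving modules\<close>

lemma fin_gen_module_copy:
  assumes fg: "fin_gen_module R N" and T: "module R T" and \<phi>: "\<phi> \<in> mod_hom R N T"
    and inj: "inj_on \<phi> (carrier N)" and surj: "carrier T = \<phi> ` carrier N"
  shows "fin_gen_module R T"
proof -
  have N: "module R N" using fg by (simp add: fin_gen_module_def)
  interpret N: module R N by fact
  interpret T: module R T by fact
  obtain S where S: "finite S" "S \<subseteq> carrier N"
    "\<And>x. x \<in> carrier N \<Longrightarrow> \<exists>c \<in> S \<rightarrow> carrier R. x = (\<Oplus>\<^bsub>N\<^esub>s\<in>S. c s \<odot>\<^bsub>N\<^esub> s)"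
    using fg unfolding fin_gen_module_def by blast
  have injS: "inj_on \<phi> S" using inj S(2) by (rule inj_on_subset)
  have "\<exists>c \<in> \<phi> ` S \<rightarrow> carrier R. y = (\<Oplus>\<^bsub>T\<^esub>t\<in>\<phi> ` S. c t \<odot>\<^bsub>T\<^esub> t)" if "y \<in> carrier T" for y
  proof -
    obtain x where x: "x \<in> carrier N" "y = \<phi> x" using \<open>y \<in> carrier T\<close> surj by auto
    obtain c where c: "c \<in> S \<rightarrow> carrier R" "x = (\<Oplus>\<^bsub>N\<^esub>s\<in>S. c s \<odot>\<^bsub>N\<^esub> s)"
      using S(3)[OF x(1)] by blast
    define c' where "c' = (\<lambda>t. c (inv_into S \<phi> t))"
    have cR: "c s \<in> carrier R" if "s \<in> S" for s using c(1) that by auto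
    have SN: "s \<in> carrier N" if "s \<in> S" for s using S(2) that by auto
    have c': "c' (\<phi> s) = c s" if "s \<in> S" for s using that injS by (simp add: c'_def)
    have "y = (\<Oplus>\<^bsub>T\<^esub>s\<in>S. \<phi> (c s \<odot>\<^bsub>N\<^esub> s))"
      unfolding x(2) c(2) using c(1) S by (intro mod_hom_finsum[OF \<phi> N T]) auto
    also have "\<dots> = (\<Oplus>\<^bsub>T\<^esub>s\<in>S. c' (\<phi> s) \<odot>\<^bsub>T\<^esub> \<phi> s)"
      by (intro T.M.finsum_cong') (simp_all add: c' cR SN mod_homD[OF \<phi>])
    also have "\<dots> = (\<Oplus>\<^bsub>T\<^esub>t\<in>\<phi> ` S. c' t \<odot>\<^bsub>T\<^esub> t)"
      by (intro T.M.finsum_reindex[symmetric] injS) (auto simp: c' cR SN mod_homD[OF \<phi>])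
    finally show ?thesis using c(1) c' by (intro bexI[of _ c']) auto
  qed
  thus ?thesis unfolding fin_gen_module_def using T S(1,2) surj
    by (intro conjI exI[of _ "\<phi> ` S"]) auto
qed

lemma projective_module_copy:
  fixes R :: "('a, 'r) ring_scheme" and P :: "('a, 'b, 'm) module_scheme"
    and T :: "('a, 'd, 'n) module_scheme"
  assumes P: "projective_module R P" and T: "module R T" and \<phi>: "\<phi> \<in> mod_hom R P T"
    and \<psi>: "\<psi> \<in> mod_hom R T P" and inv: "\<And>y. y \<in> carrier T \<Longrightarrow> \<phi> (\<psi> y) = y"
  shows "projective_module R T"
  unfolding projective_module_def
proof (intro conjI allI impI; (elim conjE)?)
  fix N N' :: "('a, 'd \<Rightarrow> 'a) module" and g f
  assume N: "module R N" and N': "module R N'" and g: "g \<in> mod_hom R N N'"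
    and surj: "g ` carrier N = carrier N'" and f: "f \<in> mod_hom R T N'"
  obtain h where h: "h \<in> mod_hom R P N" "\<And>x. x \<in> carrier P \<Longrightarrow> g (h x) = f (\<phi> x)"
    using projective_module_lift[OF P N N' g surj mod_hom_comp[OF \<phi> f]] by blast
  show "\<exists>h\<in>mod_hom R T N. \<forall>x\<in>carrier T. g (h x) = f x"
    using mod_hom_comp[OF \<psi> h(1)] h(2) inv mod_homD(1)[OF \<psi>]
    by (intro bexI[of _ "\<lambda>y. h (\<psi> y)"]) auto
qed (rule T)

lemma fin_gen_module_inj:
  fixes R :: "('a, 'r) ring_scheme" and N :: "('a, 'b, 'm) module_scheme"
  assumes "fin_gen_module R N"
  obtains \<phi> :: "'b \<Rightarrow> nat \<Rightarrow> 'a" where "inj_on \<phi> (carrier N)"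
proof -
  have "module R N" using assms by (simp add: fin_gen_module_def)
  then interpret N: module R N .
  obtain S where S: "finite S" "S \<subseteq> carrier N"
    "\<And>x. x \<in> carrier N \<Longrightarrow> \<exists>c \<in> S \<rightarrow> carrier R. x = (\<Oplus>\<^bsub>N\<^esub>s\<in>S. c s \<odot>\<^bsub>N\<^esub> s)"
    using assms unfolding fin_gen_module_def by blast
  obtain c where c: "\<And>x. x \<in> carrier N \<Longrightarrow> c x \<in> S \<rightarrow> carrier R"
    "\<And>x. x \<in> carrier N \<Longrightarrow> x = (\<Oplus>\<^bsub>N\<^esub>s\<in>S. c x s \<odot>\<^bsub>N\<^esub> s)"
    using S(3) by metis
  obtain num :: "'b \<Rightarrow> nat" where num: "inj_on num S"
    using finite_imp_inj_to_nat_seg[OF S(1)] by blast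
  have "inj_on (\<lambda>x k. c x (inv_into S num k)) (carrier N)"
  proof (rule inj_onI)
    fix x y assume x: "x \<in> carrier N" and y: "y \<in> carrier N"
      and eq: "(\<lambda>k. c x (inv_into S num k)) = (\<lambda>k. c y (inv_into S num k))"
    have "c x s = c y s" if "s \<in> S" for s
      using fun_cong[OF eq, of "num s"] that num by simp
    hence "(\<Oplus>\<^bsub>N\<^esub>s\<in>S. c x s \<odot>\<^bsub>N\<^esub> s) = (\<Oplus>\<^bsub>N\<^esub>s\<in>S. c y s \<odot>\<^bsub>N\<^esub> s)"
      using c(1)[OF y] S(2) by (intro N.M.finsum_cong') (auto simp: subset_iff)
    thus "x = y" using c(2)[OF x] c(2)[OF y] by simp
  qed
  thus thesis by (rule that)
qed

theorem FPR_of_fgp_resolution: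
  fixes R :: "('a, 'r) ring_scheme" and Q :: "nat \<Rightarrow> ('a, 'b, 'm) module_scheme"
    and M :: "('a, 'c, 'n) module_scheme"
  assumes res: "fgp_resolution R k Q d e M"
  shows "FPR R M"
proof -
  have ex: "right_exact_seq R k Q d e M" and ker: "out_kernel Q d e M k = {\<zero>\<^bsub>Q k\<^esub>}"
    and fg: "\<And>j. j \<le> k \<Longrightarrow> fin_gen_module R (Q j)"
    and pr: "\<And>j. j \<le> k \<Longrightarrow> projective_module R (Q j)"
    using res by (auto simp: fgp_resolution_def)
  have M: "module R M" and Q: "\<And>j. j \<le> k \<Longrightarrow> module R (Q j)"
    and e: "e \<in> mod_hom R (Q 0) M" and d: "\<And>j. j < k \<Longrightarrow> d j \<in> mod_hom R (Q (Suc j)) (Q j)"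
    and se: "e ` carrier (Q 0) = carrier M"
    and exd: "\<And>j. j < k \<Longrightarrow> d j ` carrier (Q (Suc j)) = out_kernel Q d e M j"
    using ex by (auto simp: right_exact_seq_def)
  have "\<forall>j. \<exists>T :: ('a, nat \<Rightarrow> 'a) module. \<exists>\<phi> \<psi>. j \<le> k \<longrightarrow>
     module R T \<and> carrier T = \<phi> ` carrier (Q j) \<and> inj_on \<phi> (carrier (Q j)) \<and>
     \<phi> \<in> mod_hom R (Q j) T \<and> \<psi> \<in> mod_hom R T (Q j) \<and>
     (\<forall>x\<in>carrier (Q j). \<psi> (\<phi> x) = x) \<and> (\<forall>y\<in>carrier T. \<phi> (\<psi> y) = y) \<and> \<zero>\<^bsub>T\<^esub> = \<phi> \<zero>\<^bsub>Q j\<^esub>"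
  proof
    fix j show "\<exists>T :: ('a, nat \<Rightarrow> 'a) module. \<exists>\<phi> \<psi>. j \<le> k \<longrightarrow>
     module R T \<and> carrier T = \<phi> ` carrier (Q j) \<and> inj_on \<phi> (carrier (Q j)) \<and>
     \<phi> \<in> mod_hom R (Q j) T \<and> \<psi> \<in> mod_hom R T (Q j) \<and>
     (\<forall>x\<in>carrier (Q j). \<psi> (\<phi> x) = x) \<and> (\<forall>y\<in>carrier T. \<phi> (\<psi> y) = y) \<and> \<zero>\<^bsub>T\<^esub> = \<phi> \<zero>\<^bsub>Q j\<^esub>"
    proof (cases "j \<le> k")
      case True
      obtain \<phi> :: "_ \<Rightarrow> nat \<Rightarrow> 'a" where inj: "inj_on \<phi> (carrier (Q j))"
        using fin_gen_module_inj[OF fg[OF True]] .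
      obtain T :: "('a, nat \<Rightarrow> 'a) module" and \<psi> where
        "module R T" "carrier T = \<phi> ` carrier (Q j)" "\<phi> \<in> mod_hom R (Q j) T"
        "\<psi> \<in> mod_hom R T (Q j)" "\<And>x. x \<in> carrier (Q j) \<Longrightarrow> \<psi> (\<phi> x) = x"
        "\<And>y. y \<in> carrier T \<Longrightarrow> \<phi> (\<psi> y) = y" "\<zero>\<^bsub>T\<^esub> = \<phi> \<zero>\<^bsub>Q j\<^esub>"
        by (rule bij_module_copy[OF Q[OF True] inj]) blast
      with inj show ?thesis by blast
    qed simp
  qed
  then obtain T :: "nat \<Rightarrow> ('a, nat \<Rightarrow> 'a) module" and \<phi> \<psi> where all: "\<And>j. j \<le> k \<Longrightarrow>
     module R (T j) \<and> carrier (T j) = \<phi> j ` carrier (Q j) \<and> inj_on (\<phi> j) (carrier (Q j)) \<and>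
     \<phi> j \<in> mod_hom R (Q j) (T j) \<and> \<psi> j \<in> mod_hom R (T j) (Q j) \<and>
     (\<forall>x\<in>carrier (Q j). \<psi> j (\<phi> j x) = x) \<and> (\<forall>y\<in>carrier (T j). \<phi> j (\<psi> j y) = y) \<and>
     \<zero>\<^bsub>T j\<^esub> = \<phi> j \<zero>\<^bsub>Q j\<^esub>"
    by metis
  have T: "module R (T j)" "carrier (T j) = \<phi> j ` carrier (Q j)" "inj_on (\<phi> j) (carrier (Q j))"
    "\<phi> j \<in> mod_hom R (Q j) (T j)" "\<psi> j \<in> mod_hom R (T j) (Q j)"
    "\<And>x. x \<in> carrier (Q j) \<Longrightarrow> \<psi> j (\<phi> j x) = x" "\<And>y. y \<in> carrier (T j) \<Longrightarrow> \<phi> j (\<psi> j y) = y"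
    "\<zero>\<^bsub>T j\<^esub> = \<phi> j \<zero>\<^bsub>Q j\<^esub>"
    if "j \<le> k" for j using all[OF that] by blast+
  define e' where "e' = (\<lambda>y. e (\<psi> 0 y))"
  define d' where "d' = (\<lambda>j y. \<phi> j (d j (\<psi> (Suc j) y)))"
  have e': "e' \<in> mod_hom R (T 0) M"
    unfolding e'_def by (rule mod_hom_comp[OF T(5) e]) simp
  have d': "d' j \<in> mod_hom R (T (Suc j)) (T j)" if "j < k" for j
    unfolding d'_def
    by (rule mod_hom_comp[OF mod_hom_comp[OF T(5) d] T(4)]) (use that in auto)
  have ok: "out_kernel T d' e' M j = \<phi> j ` out_kernel Q d e M j" if j: "j \<le> k" for j
  proof (cases j)
    case 0
    show ?thesis using T(2,6)[of 0] by (auto simp: 0 e'_def a_kernel_def')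
  next
    case (Suc i)
    have i: "i < k" "i \<le> k" using Suc j by auto
    have z: "\<zero>\<^bsub>Q i\<^esub> \<in> carrier (Q i)"
      using Q[OF i(2)] by (meson abelian_group.a_inv_closed abelian_monoid.zero_closed
          abelian_group_def module_def)
    have "\<phi> i (d i x) = \<zero>\<^bsub>T i\<^esub> \<longleftrightarrow> d i x = \<zero>\<^bsub>Q i\<^esub>" if "x \<in> carrier (Q j)" for x
      using T(3,8)[OF i(2)] z mod_homD(1)[OF d[OF i(1)]] that Suc by (auto simp: inj_on_eq_iff)
    thus ?thesis using T(2,6)[OF j] T(8)[OF i(2), symmetric]
      by (auto simp: Suc d'_def a_kernel_def')
  qed
  have "right_exact_seq R k T d' e' M"
    unfolding right_exact_seq_def
  proof (intro conjI allI impI)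
    show "e' ` carrier (T 0) = carrier M"
      using se T(2,6)[of 0] by (auto simp: e'_def image_image)
    fix j assume j: "j < k"
    have "d' j ` carrier (T (Suc j)) = \<phi> j ` d j ` carrier (Q (Suc j))"
      using T(2,6)[of "Suc j"] j by (auto simp: d'_def image_image)
    also have "\<dots> = out_kernel T d' e' M j"
      using exd[OF j] ok[of j] j by simp
    finally show "d' j ` carrier (T (Suc j)) = out_kernel T d' e' M j" .
  qed (use M T e' d' in auto)
  moreover have "out_kernel T d' e' M k = {\<zero>\<^bsub>T k\<^esub>}"
    using ok[of k] ker T(8)[of k] by simp
  moreover have "fin_gen_module R (T j) \<and> projective_module R (T j)" if "j \<le> k" for j
    using fin_gen_module_copy[OF fg T(1,4,3,2)] projective_module_copy[OF pr T(1,4,5,7)] that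
    by blast
  ultimately show ?thesis
    unfolding FPR_def fgp_resolution_def by blast
qed

end

theory Submission
  imports Defs
begin

text \<open>
  A module is in the class iff it is a quotient of a finitely generated projective module by a
  submodule in the class. The horseshoe construction and induction along a resolution of \<open>C\<close> give
  (b). For (c), with \<open>P \<rightarrow> B\<close> the start of a resolution and \<open>K\<close> its kernel, the kernel of the
  composite \<open>P \<rightarrow> C\<close> is an extension of \<open>A\<close> by \<open>K\<close>. For (d), \<open>A \<oplus> P\<close> is an extension of \<open>B\<close> by \<open>K\<close>
  when \<open>0 \<rightarrow> K \<rightarrow> P \<rightarrow> C \<rightarrow> 0\<close> starts a resolution of \<open>C\<close>, and (b) and (c) apply. Part (a) is a special
  case of these, and (2) splits into short exact sequences.
\<close>

section \<open>Short exact sequences\<close>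

lemma mod_hom_minus:
  assumes f: "f \<in> mod_hom R M N" and M: "module R M" and N: "module R N" and x: "x \<in> carrier M"
  shows "f (\<ominus>\<^bsub>M\<^esub> x) = \<ominus>\<^bsub>N\<^esub> f x"
proof -
  interpret M: module R M by fact
  interpret N: module R N by fact
  have "f (\<ominus>\<^bsub>M\<^esub> x) \<oplus>\<^bsub>N\<^esub> f x = f (\<ominus>\<^bsub>M\<^esub> x \<oplus>\<^bsub>M\<^esub> x)"
    using x by (simp add: mod_homD(2)[OF f])
  also have "\<dots> = \<zero>\<^bsub>N\<^esub>"
    using x by (simp add: M.M.l_neg mod_hom_zero[OF f M N])
  finally show ?thesis
    using x mod_homD(1)[OF f] by (intro N.M.minus_equality[symmetric]) auto
qed

lemma mod_hom_inj_on_iff: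
  assumes f: "f \<in> mod_hom R M N" and M: "module R M" and N: "module R N"
  shows "inj_on f (carrier M) \<longleftrightarrow> (\<forall>x\<in>carrier M. f x = \<zero>\<^bsub>N\<^esub> \<longrightarrow> x = \<zero>\<^bsub>M\<^esub>)"
proof -
  interpret M: module R M by fact
  interpret N: module R N by fact
  show ?thesis
  proof (intro iffI ballI impI inj_onI)
    fix x assume "inj_on f (carrier M)" "x \<in> carrier M" "f x = \<zero>\<^bsub>N\<^esub>"
    thus "x = \<zero>\<^bsub>M\<^esub>" using mod_hom_zero[OF f M N] by (metis M.M.zero_closed inj_onD)
  next
    fix x y assume k: "\<forall>x\<in>carrier M. f x = \<zero>\<^bsub>N\<^esub> \<longrightarrow> x = \<zero>\<^bsub>M\<^esub>"
      and x: "x \<in> carrier M" and y: "y \<in> carrier M" and eq: "f x = f y"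
    have "f (x \<oplus>\<^bsub>M\<^esub> \<ominus>\<^bsub>M\<^esub> y) = f y \<oplus>\<^bsub>N\<^esub> \<ominus>\<^bsub>N\<^esub> f y"
      using x y by (simp add: mod_homD(2)[OF f] mod_hom_minus[OF f M N] eq)
    also have "\<dots> = \<zero>\<^bsub>N\<^esub>" using mod_homD(1)[OF f y] by (rule N.M.r_neg)
    finally have "x \<oplus>\<^bsub>M\<^esub> \<ominus>\<^bsub>M\<^esub> y = \<zero>\<^bsub>M\<^esub>" using k x y by simp
    thus "x = y" using x y M.M.minus_unique[of x "\<ominus>\<^bsub>M\<^esub> y" y] M.M.l_neg
      by (metis M.M.add.inv_closed M.M.minus_equality M.M.minus_minus)
  qed
qed

text \<open>Preimages under an injective \<open>f\<close> are unique, so choosing them pointwise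
  with \<open>inv_into\<close> is automatically linear: both sides of each equation have the same
  image under \<open>f\<close>. This is how maps between kernels are produced below.\<close>

lemma mod_hom_factor:
  assumes f: "f \<in> mod_hom R A B" and inj: "inj_on f (carrier A)"
    and u: "u \<in> mod_hom R X B" and im: "\<And>x. x \<in> carrier X \<Longrightarrow> u x \<in> f ` carrier A"
    and A: "module R A"
  obtains v where "v \<in> mod_hom R X A" "\<And>x. x \<in> carrier X \<Longrightarrow> f (v x) = u x"
proof -
  interpret A: module R A by fact
  let ?v = "\<lambda>x. inv_into (carrier A) f (u x)"
  have v: "?v x \<in> carrier A" "f (?v x) = u x" if "x \<in> carrier X" for x
    using im[OF that] by (auto intro: inv_into_into f_inv_into_f)
  have inv: "inv_into (carrier A) f y = a" if "a \<in> carrier A" "f a = y" for a y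
    using inv_into_f_f[OF inj that(1)] that(2) by simp
  have "?v \<in> mod_hom R X A"
    using v by (intro mod_homI inv) (auto simp: mod_homD[OF f] mod_homD[OF u])
  thus thesis using v(2) by (rule that)
qed

lemma short_exactI:
  assumes "module R A" "module R B" "module R C" "f \<in> mod_hom R A B" "g \<in> mod_hom R B C"
    and "\<And>x. x \<in> carrier A \<Longrightarrow> f x = \<zero>\<^bsub>B\<^esub> \<Longrightarrow> x = \<zero>\<^bsub>A\<^esub>"
    and "\<And>x. x \<in> carrier A \<Longrightarrow> g (f x) = \<zero>\<^bsub>C\<^esub>"
    and "\<And>y. y \<in> carrier B \<Longrightarrow> g y = \<zero>\<^bsub>C\<^esub> \<Longrightarrow> y \<in> f ` carrier A"
    and "\<And>z. z \<in> carrier C \<Longrightarrow> z \<in> g ` carrier B"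
  shows "short_exact R A f B g C"
proof -
  interpret A: module R A by fact
  have "a_kernel A B f = {\<zero>\<^bsub>A\<^esub>}"
    using assms(6) mod_hom_zero[OF assms(4,1,2)] by (auto simp: a_kernel_def')
  moreover have "f ` carrier A = a_kernel B C g"
    using assms(7,8) mod_homD(1)[OF assms(4)] by (auto simp: a_kernel_def')
  moreover have "g ` carrier B = carrier C"
    using assms(9) mod_homD(1)[OF assms(5)] by auto
  ultimately show ?thesis using assms(1-5) by (simp add: short_exact_def)
qed

lemma short_exactD:
  assumes "short_exact R A f B g C"
  shows "module R A" "module R B" "module R C" "f \<in> mod_hom R A B" "g \<in> mod_hom R B C"
    and "inj_on f (carrier A)"
    and "x \<in> carrier A \<Longrightarrow> g (f x) = \<zero>\<^bsub>C\<^esub>"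
    and "y \<in> carrier B \<Longrightarrow> g y = \<zero>\<^bsub>C\<^esub> \<Longrightarrow> y \<in> f ` carrier A"
    and "g ` carrier B = carrier C"
    and "f ` carrier A = a_kernel B C g"
proof -
  show *: "module R A" "module R B" "module R C" "f \<in> mod_hom R A B" "g \<in> mod_hom R B C"
    "g ` carrier B = carrier C" "f ` carrier A = a_kernel B C g"
    using assms by (auto simp: short_exact_def)
  have k: "a_kernel A B f = {\<zero>\<^bsub>A\<^esub>}"
    using assms by (auto simp: short_exact_def)
  show "inj_on f (carrier A)"
    unfolding mod_hom_inj_on_iff[OF *(4,1,2)] using k by (auto simp: a_kernel_def')
  show "g (f x) = \<zero>\<^bsub>C\<^esub>" if "x \<in> carrier A"
    using *(7) that by (auto simp: a_kernel_def')
  show "y \<in> f ` carrier A" if "y \<in> carrier B" "g y = \<zero>\<^bsub>C\<^esub>"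
    unfolding *(7) using that by (auto simp: a_kernel_def')
qed

text \<open>Only the carrier of \<open>M\<close> is replaced, so operations and zero stay those of
  \<open>M\<close> and the inclusion is literally the identity function.\<close>

abbreviation (input) ker_mod ::
    "('a, 'b, 'm) module_scheme \<Rightarrow> ('a, 'c, 'n) module_scheme \<Rightarrow> ('b \<Rightarrow> 'c) \<Rightarrow> ('a, 'b, 'm) module_scheme"
  where "ker_mod M N f \<equiv> M\<lparr>carrier := a_kernel M N f\<rparr>"

lemma ker_mod_module:
  assumes f: "f \<in> mod_hom R M N" and M: "module R M" and N: "module R N"
  shows "module R (ker_mod M N f)"
proof -
  interpret M: module R M by fact
  interpret N: module R N by fact
  have "submodule (a_kernel M N f) R M"
    by (rule M.submoduleI)
      (auto simp: a_kernel_def' mod_hom_zero[OF f M N] mod_hom_minus[OF f M N] mod_homD[OF f])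
  thus ?thesis using M by (rule submodule.submodule_is_module)
qed

lemma short_exact_ker_mod:
  assumes f: "f \<in> mod_hom R M N" and M: "module R M" and N: "module R N"
    and surj: "f ` carrier M = carrier N"
  shows "short_exact R (ker_mod M N f) (\<lambda>x. x) M f N"
  by (rule short_exactI[OF ker_mod_module[OF f M N] M N _ f])
    (use surj in \<open>auto simp: a_kernel_def' intro!: mod_homI\<close>)

text \<open>Moves the middle term along an isomorphism. It serves to bring that term to the carrier
  type \<open>nat \<Rightarrow> 'a\<close>, on which the resolutions in \<open>FPR\<close> are
  built.\<close>

lemma short_exact_copy_mid:
  assumes "short_exact R A f B g C" and B': "module R B'"
    and \<phi>: "\<phi> \<in> mod_hom R B B'" and \<psi>: "\<psi> \<in> mod_hom R B' B"
    and inv: "\<And>x. x \<in> carrier B \<Longrightarrow> \<psi> (\<phi> x) = x" "\<And>y. y \<in> carrier B' \<Longrightarrow> \<phi> (\<psi> y) = y"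
  shows "short_exact R A (\<lambda>x. \<phi> (f x)) B' (\<lambda>y. g (\<psi> y)) C"
proof -
  note se = short_exactD[OF assms(1)]
  note hom = mod_homD(1)[OF \<phi>] mod_homD(1)[OF \<psi>] mod_homD(1)[OF se(4)] mod_homD(1)[OF se(5)]
  show ?thesis
  proof (rule short_exactI[OF se(1) B' se(3) mod_hom_comp[OF se(4) \<phi>] mod_hom_comp[OF \<psi> se(5)]])
    fix x assume x: "x \<in> carrier A" "\<phi> (f x) = \<zero>\<^bsub>B'\<^esub>"
    hence "f x = \<zero>\<^bsub>B\<^esub>"
      using inv(1)[of "f x"] hom(3) mod_hom_zero[OF \<psi> B' se(2)] by auto
    thus "x = \<zero>\<^bsub>A\<^esub>" using x(1) se(6) mod_hom_inj_on_iff[OF se(4,1,2)] by blast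
  next
    fix x assume "x \<in> carrier A" thus "g (\<psi> (\<phi> (f x))) = \<zero>\<^bsub>C\<^esub>" using se(7) hom(3) inv(1) by simp
  next
    fix y assume y: "y \<in> carrier B'" "g (\<psi> y) = \<zero>\<^bsub>C\<^esub>"
    then obtain x where "x \<in> carrier A" "\<psi> y = f x" using se(8) hom(2) by blast
    thus "y \<in> (\<lambda>x. \<phi> (f x)) ` carrier A" using inv(2)[OF y(1)] by (metis image_eqI)
  next
    fix z assume "z \<in> carrier C"
    then obtain y where "y \<in> carrier B" "z = g y" using se(9) by blast
    thus "z \<in> (\<lambda>y. g (\<psi> y)) ` carrier B'" using inv(1) hom(1) by (metis image_eqI)
  qed
qed

section \<open>Direct sums\<close>

definition dsum ::
    "('a, 'b, 'm) module_scheme \<Rightarrow> ('a, 'c, 'n) module_scheme \<Rightarrow> ('a, 'b \<times> 'c) module"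
  where "dsum M N =
    \<lparr>carrier = carrier M \<times> carrier N, mult = undefined, one = undefined,
     zero = (\<zero>\<^bsub>M\<^esub>, \<zero>\<^bsub>N\<^esub>), add = (\<lambda>x y. (fst x \<oplus>\<^bsub>M\<^esub> fst y, snd x \<oplus>\<^bsub>N\<^esub> snd y)),
     smult = (\<lambda>a x. (a \<odot>\<^bsub>M\<^esub> fst x, a \<odot>\<^bsub>N\<^esub> snd x))\<rparr>"

lemma dsum_simps [simp]:
  "carrier (dsum M N) = carrier M \<times> carrier N"
  "\<zero>\<^bsub>dsum M N\<^esub> = (\<zero>\<^bsub>M\<^esub>, \<zero>\<^bsub>N\<^esub>)"
  "x \<oplus>\<^bsub>dsum M N\<^esub> y = (fst x \<oplus>\<^bsub>M\<^esub> fst y, snd x \<oplus>\<^bsub>N\<^esub> snd y)"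
  "a \<odot>\<^bsub>dsum M N\<^esub> x = (a \<odot>\<^bsub>M\<^esub> fst x, a \<odot>\<^bsub>N\<^esub> snd x)"
  by (simp_all add: dsum_def)

lemma dsum_module:
  assumes M: "module R M" and N: "module R N"
  shows "module R (dsum M N)"
proof -
  interpret M: module R M by fact
  interpret N: module R N by fact
  have "abelian_group (dsum M N)"
  proof (rule abelian_groupI)
    fix x assume "x \<in> carrier (dsum M N)"
    thus "\<exists>y\<in>carrier (dsum M N). y \<oplus>\<^bsub>dsum M N\<^esub> x = \<zero>\<^bsub>dsum M N\<^esub>"
      by (intro bexI[of _ "(\<ominus>\<^bsub>M\<^esub> fst x, \<ominus>\<^bsub>N\<^esub> snd x)"]) (auto simp: M.M.l_neg N.M.l_neg)
  qed (auto simp: M.M.a_ac N.M.a_ac)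
  thus ?thesis
    by (intro moduleI)
       (auto simp: M.smult_l_distr M.smult_r_distr M.smult_assoc1
          N.smult_l_distr N.smult_r_distr N.smult_assoc1 M.R.is_cring)
qed

lemma dsum_homs:
  assumes M: "module R M" and N: "module R N"
  shows "(\<lambda>x. (x, \<zero>\<^bsub>N\<^esub>)) \<in> mod_hom R M (dsum M N)" "(\<lambda>y. (\<zero>\<^bsub>M\<^esub>, y)) \<in> mod_hom R N (dsum M N)"
    "fst \<in> mod_hom R (dsum M N) M" "snd \<in> mod_hom R (dsum M N) N"
proof -
  interpret M: module R M by fact
  interpret N: module R N by fact
  show "(\<lambda>x. (x, \<zero>\<^bsub>N\<^esub>)) \<in> mod_hom R M (dsum M N)" "(\<lambda>y. (\<zero>\<^bsub>M\<^esub>, y)) \<in> mod_hom R N (dsum M N)"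
    "fst \<in> mod_hom R (dsum M N) M" "snd \<in> mod_hom R (dsum M N) N"
    by (auto intro!: mod_homI)
qed

lemma mod_hom_add:
  assumes u: "u \<in> mod_hom R X L" and v: "v \<in> mod_hom R X L" and L: "module R L"
  shows "(\<lambda>x. u x \<oplus>\<^bsub>L\<^esub> v x) \<in> mod_hom R X L"
proof -
  interpret L: module R L by fact
  show ?thesis
    by (rule mod_homI) (auto simp: mod_homD[OF u] mod_homD[OF v] L.smult_r_distr L.M.a_ac)
qed

lemma mod_hom_dsum:
  assumes u: "u \<in> mod_hom R M L" and v: "v \<in> mod_hom R N L"
    and M: "module R M" and N: "module R N" and L: "module R L"
  shows "(\<lambda>x. u (fst x) \<oplus>\<^bsub>L\<^esub> v (snd x)) \<in> mod_hom R (dsum M N) L"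
  by (rule mod_hom_add[OF mod_hom_comp[OF dsum_homs(3)[OF M N] u]
        mod_hom_comp[OF dsum_homs(4)[OF M N] v] L])

text \<open>Lift on each summand and add the lifts. The test modules have the type belonging to the
  pair type, not to \<open>P\<close> or \<open>Q\<close>, so the lifts come from
  \<open>projective_module_lift\<close> rather than from the definition.\<close>

lemma dsum_projective:
  fixes R :: "('a, 'r) ring_scheme"
    and P :: "('a, 'b, 'm) module_scheme" and Q :: "('a, 'c, 'n) module_scheme"
  assumes P: "projective_module R P" and Q: "projective_module R Q"
  shows "projective_module R (dsum P Q)"
  unfolding projective_module_def
proof (intro conjI allI impI; (elim conjE)?)
  have mP: "module R P" and mQ: "module R Q"
    using P Q by (simp_all add: projective_module_def)
  show "module R (dsum P Q)" by (rule dsum_module[OF mP mQ])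
  fix N N' :: "('a, 'b \<times> 'c \<Rightarrow> 'a) module" and g f
  assume N: "module R N" and N': "module R N'" and g: "g \<in> mod_hom R N N'"
    and surj: "g ` carrier N = carrier N'" and f: "f \<in> mod_hom R (dsum P Q) N'"
  interpret P: module R P by (rule mP)
  interpret Q: module R Q by (rule mQ)
  obtain h where h: "h \<in> mod_hom R P N" "\<And>x. x \<in> carrier P \<Longrightarrow> g (h x) = f (x, \<zero>\<^bsub>Q\<^esub>)"
    using projective_module_lift[OF P N N' g surj mod_hom_comp[OF dsum_homs(1)[OF mP mQ] f]] by blast
  obtain k where k: "k \<in> mod_hom R Q N" "\<And>y. y \<in> carrier Q \<Longrightarrow> g (k y) = f (\<zero>\<^bsub>P\<^esub>, y)"
    using projective_module_lift[OF Q N N' g surj mod_hom_comp[OF dsum_homs(2)[OF mP mQ] f]] by blast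
  have "g (h x \<oplus>\<^bsub>N\<^esub> k y) = f (x, y)" if "x \<in> carrier P" "y \<in> carrier Q" for x y
  proof -
    have "g (h x \<oplus>\<^bsub>N\<^esub> k y) = f (x, \<zero>\<^bsub>Q\<^esub>) \<oplus>\<^bsub>N'\<^esub> f (\<zero>\<^bsub>P\<^esub>, y)"
      using that by (simp add: mod_homD(2)[OF g] mod_homD(1)[OF h(1)] mod_homD(1)[OF k(1)] h k)
    also have "\<dots> = f (x, y)"
      using that mod_homD(2)[OF f, of "(x, \<zero>\<^bsub>Q\<^esub>)" "(\<zero>\<^bsub>P\<^esub>, y)"] by simp
    finally show ?thesis .
  qed
  thus "\<exists>h\<in>mod_hom R (dsum P Q) N. \<forall>x\<in>carrier (dsum P Q). g (h x) = f x"
    by (intro bexI[OF _ mod_hom_dsum[OF h(1) k(1) mP mQ N]]) auto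
qed

section \<open>Linear spans and finite generation of direct sums\<close>

definition lin_span :: "('a, 'r) ring_scheme \<Rightarrow> ('a, 'b, 'm) module_scheme \<Rightarrow> 'b set \<Rightarrow> 'b set"
  where "lin_span R M S = {x. \<exists>c \<in> S \<rightarrow> carrier R. x = (\<Oplus>\<^bsub>M\<^esub>s\<in>S. c s \<odot>\<^bsub>M\<^esub> s)}"

lemma fin_gen_module_iff_lin_span:
  "fin_gen_module R M \<longleftrightarrow> module R M \<and>
    (\<exists>S. finite S \<and> S \<subseteq> carrier M \<and> carrier M \<subseteq> lin_span R M S)"
  by (simp add: fin_gen_module_def lin_span_def subset_eq)

lemma lin_span_mono:
  assumes M: "module R M" and S: "finite S'" "S \<subseteq> S'" "S' \<subseteq> carrier M"
  shows "lin_span R M S \<subseteq> lin_span R M S'"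
proof
  interpret M: module R M by fact
  fix x assume "x \<in> lin_span R M S"
  then obtain c where c: "c \<in> S \<rightarrow> carrier R" "x = (\<Oplus>\<^bsub>M\<^esub>s\<in>S. c s \<odot>\<^bsub>M\<^esub> s)"
    by (auto simp: lin_span_def)
  let ?c = "\<lambda>s. if s \<in> S then c s else \<zero>\<^bsub>R\<^esub>"
  have "x = (\<Oplus>\<^bsub>M\<^esub>s\<in>S'. ?c s \<odot>\<^bsub>M\<^esub> s)"
    unfolding c(2) by (rule M.M.add.finprod_mono_neutral_cong_left) (use S c(1) in \<open>auto simp: Pi_iff subset_iff\<close>)
  moreover have "?c \<in> S' \<rightarrow> carrier R" using c(1) by auto
  ultimately show "x \<in> lin_span R M S'"
    unfolding lin_span_def by (intro CollectI bexI[of _ ?c])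
qed

lemma lin_span_add:
  assumes M: "module R M" and S: "S \<subseteq> carrier M"
    and x: "x \<in> lin_span R M S" and y: "y \<in> lin_span R M S"
  shows "x \<oplus>\<^bsub>M\<^esub> y \<in> lin_span R M S"
proof -
  interpret M: module R M by fact
  obtain c where c: "c \<in> S \<rightarrow> carrier R" "x = (\<Oplus>\<^bsub>M\<^esub>s\<in>S. c s \<odot>\<^bsub>M\<^esub> s)"
    using x by (auto simp: lin_span_def)
  obtain c' where c': "c' \<in> S \<rightarrow> carrier R" "y = (\<Oplus>\<^bsub>M\<^esub>s\<in>S. c' s \<odot>\<^bsub>M\<^esub> s)"
    using y by (auto simp: lin_span_def)
  have "x \<oplus>\<^bsub>M\<^esub> y = (\<Oplus>\<^bsub>M\<^esub>s\<in>S. c s \<odot>\<^bsub>M\<^esub> s \<oplus>\<^bsub>M\<^esub> c' s \<odot>\<^bsub>M\<^esub> s)"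
    unfolding c(2) c'(2) using c(1) c'(1) S by (intro M.M.finsum_addf[symmetric]) auto
  also have "\<dots> = (\<Oplus>\<^bsub>M\<^esub>s\<in>S. (c s \<oplus>\<^bsub>R\<^esub> c' s) \<odot>\<^bsub>M\<^esub> s)"
    using c(1) c'(1) S by (intro M.M.finsum_cong') (auto simp: M.smult_l_distr Pi_iff subset_iff)
  finally show ?thesis
    unfolding lin_span_def using c(1) c'(1) by (intro CollectI bexI[of _ "\<lambda>s. c s \<oplus>\<^bsub>R\<^esub> c' s"]) auto
qed

text \<open>Injectivity of \<open>f\<close> keeps distinct generators distinct, so each coefficient
  can be carried over unchanged through \<open>inv_into\<close>.\<close>

lemma lin_span_image:
  assumes M: "module R M" and N: "module R N" and f: "f \<in> mod_hom R M N"
    and inj: "inj_on f (carrier M)" and S: "finite S" "S \<subseteq> carrier M" and x: "x \<in> lin_span R M S"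
  shows "f x \<in> lin_span R N (f ` S)"
proof -
  interpret M: module R M by fact
  interpret N: module R N by fact
  obtain c where c: "c \<in> S \<rightarrow> carrier R" "x = (\<Oplus>\<^bsub>M\<^esub>s\<in>S. c s \<odot>\<^bsub>M\<^esub> s)"
    using x by (auto simp: lin_span_def)
  have injS: "inj_on f S" using inj S(2) by (rule inj_on_subset)
  let ?c = "\<lambda>t. c (inv_into S f t)"
  have c': "?c (f s) = c s" if "s \<in> S" for s using that injS by simp
  have cR: "c s \<in> carrier R" if "s \<in> S" for s using c(1) that by auto
  have SM: "s \<in> carrier M" if "s \<in> S" for s using S(2) that by auto
  have "f x = (\<Oplus>\<^bsub>N\<^esub>s\<in>S. f (c s \<odot>\<^bsub>M\<^esub> s))"
    unfolding c(2) using cR SM S(1) by (intro mod_hom_finsum[OF f M N]) auto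
  also have "\<dots> = (\<Oplus>\<^bsub>N\<^esub>s\<in>S. ?c (f s) \<odot>\<^bsub>N\<^esub> f s)"
    by (intro N.M.finsum_cong') (simp_all add: c' cR SM mod_homD[OF f])
  also have "\<dots> = (\<Oplus>\<^bsub>N\<^esub>t\<in>f ` S. ?c t \<odot>\<^bsub>N\<^esub> t)"
    by (intro N.M.finsum_reindex[symmetric] injS) (auto simp: c' cR SM mod_homD[OF f])
  finally show ?thesis unfolding lin_span_def using cR c' by (intro CollectI bexI[of _ ?c]) auto
qed

lemma dsum_fin_gen:
  assumes M: "fin_gen_module R M" and N: "fin_gen_module R N"
  shows "fin_gen_module R (dsum M N)"
proof -
  obtain S where S: "module R M" "finite S" "S \<subseteq> carrier M" "carrier M \<subseteq> lin_span R M S"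
    using M by (auto simp: fin_gen_module_iff_lin_span)
  obtain T where T: "module R N" "finite T" "T \<subseteq> carrier N" "carrier N \<subseteq> lin_span R N T"
    using N by (auto simp: fin_gen_module_iff_lin_span)
  interpret M: module R M by (rule S)
  interpret N: module R N by (rule T)
  let ?D = "dsum M N" and ?i = "\<lambda>x. (x, \<zero>\<^bsub>N\<^esub>)" and ?j = "\<lambda>y. (\<zero>\<^bsub>M\<^esub>, y)"
  \<comment> \<open>The two embedded generating sets may share the zero element. This does no harm:
    each component is first put in the span of all of \<open>?U\<close>, and only then are the two
    combinations added.\<close>
  let ?U = "?i ` S \<union> ?j ` T"
  note D = dsum_module[OF S(1) T(1)]
  have U: "finite ?U" "?U \<subseteq> carrier ?D" using S T by auto
  have "carrier ?D \<subseteq> lin_span R ?D ?U"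
  proof
    fix z assume "z \<in> carrier ?D"
    then obtain x y where z: "z = (x, y)" "x \<in> carrier M" "y \<in> carrier N" by auto
    have "?i x \<in> lin_span R ?D (?i ` S)"
      by (rule lin_span_image[OF S(1) D dsum_homs(1)[OF S(1) T(1)]])
        (use S z in \<open>auto simp: inj_on_def\<close>)
    moreover have "?j y \<in> lin_span R ?D (?j ` T)"
      by (rule lin_span_image[OF T(1) D dsum_homs(2)[OF S(1) T(1)]])
        (use T z in \<open>auto simp: inj_on_def\<close>)
    ultimately have "?i x \<oplus>\<^bsub>?D\<^esub> ?j y \<in> lin_span R ?D ?U"
      using lin_span_mono[OF D U(1) _ U(2)] by (intro lin_span_add[OF D U(2)]) blast+
    thus "z \<in> lin_span R ?D ?U" using z by simp
  qed
  with D U show ?thesis unfolding fin_gen_module_iff_lin_span by blast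
qed

section \<open>Building and decomposing finite resolutions\<close>

abbreviation (input) fgp_module :: "('a, 'r) ring_scheme \<Rightarrow> ('a, 'b, 'm) module_scheme \<Rightarrow> bool"
  where "fgp_module R P \<equiv> fin_gen_module R P \<and> projective_module R P"

lemma zero_module_fgp:
  fixes M :: "('a, 'b, 'm) module_scheme"
  assumes M: "module R M" and z: "carrier M = {\<zero>\<^bsub>M\<^esub>}"
  shows "fgp_module R M"
proof
  interpret M: module R M by fact
  show "fin_gen_module R M"
    unfolding fin_gen_module_def using M z by (intro conjI exI[of _ "{}"]) auto
  show "projective_module R M"
    unfolding projective_module_def
  proof (intro conjI allI impI M; (elim conjE)?)
    fix N N' :: "('a, 'b \<Rightarrow> 'a) module" and g f
    assume N: "module R N" and N': "module R N'" and g: "g \<in> mod_hom R N N'" and f: "f \<in> mod_hom R M N'"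
    interpret N: module R N by fact
    show "\<exists>h\<in>mod_hom R M N. \<forall>x\<in>carrier M. g (h x) = f x"
      using z mod_hom_zero[OF g N N'] mod_hom_zero[OF f M N']
      by (intro bexI[of _ "\<lambda>_. \<zero>\<^bsub>N\<^esub>"] mod_homI) auto
  qed
qed

lemma FPR_module: "FPR R M \<Longrightarrow> module R M"
  by (auto simp: FPR_def fgp_resolution_def right_exact_seq_def)

text \<open>\<open>P\<close> resolves itself in length 0, with the identity as augmentation. There
  is no differential for \<open>k = 0\<close>, so the value given for it is a filler.\<close>

lemma FPR_fgp:
  assumes "fgp_module R P"
  shows "FPR R P"
proof (rule FPR_of_fgp_resolution)
  have "module R P" using assms by (simp add: fin_gen_module_def)
  then interpret P: module R P .
  show "fgp_resolution R 0 (\<lambda>_. P) (\<lambda>_ x. x) (\<lambda>x. x) P"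
    using assms \<open>module R P\<close>
    by (auto simp: fgp_resolution_def right_exact_seq_def a_kernel_def' intro: mod_homI)
qed

text \<open>The resolution is kept and only its augmentation is composed with the isomorphism, which
  leaves every kernel the same.\<close>

lemma FPR_iso:
  assumes M: "FPR R M" and N: "module R N" and \<phi>: "\<phi> \<in> mod_hom R M N"
    and inj: "inj_on \<phi> (carrier M)" and surj: "\<phi> ` carrier M = carrier N"
  shows "FPR R N"
proof -
  obtain k and Q :: "nat \<Rightarrow> ('a, nat \<Rightarrow> 'a) module" and d e where r: "fgp_resolution R k Q d e M"
    using M by (auto simp: FPR_def)
  have modM: "module R M" using M by (rule FPR_module)
  have e: "e \<in> mod_hom R (Q 0) M" and se: "e ` carrier (Q 0) = carrier M"
    using r by (auto simp: fgp_resolution_def right_exact_seq_def)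
  have "out_kernel Q d (\<lambda>x. \<phi> (e x)) N j = out_kernel Q d e M j" for j
    using mod_hom_zero[OF \<phi> modM N] inj mod_homD(1)[OF e]
    by (cases j) (auto simp: a_kernel_def' mod_hom_inj_on_iff[OF \<phi> modM N])
  moreover have "(\<lambda>x. \<phi> (e x)) ` carrier (Q 0) = carrier N"
    using se surj by (auto simp: image_image[symmetric])
  ultimately have "fgp_resolution R k Q d (\<lambda>x. \<phi> (e x)) N"
    using r N mod_hom_comp[OF e \<phi>] by (simp add: fgp_resolution_def right_exact_seq_def)
  thus ?thesis unfolding FPR_def by blast
qed

text \<open>Splicing: a resolution of \<open>A\<close> followed by \<open>B\<close> resolves
  \<open>C\<close>, with \<open>f\<close> after the augmentation of \<open>A\<close> as the joining
  differential. All terms of a resolution share one type, so \<open>B\<close> is first replaced by a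
  copy \<open>B'\<close>.\<close>

lemma FPR_step:
  assumes se: "short_exact R A f B g C" and A: "FPR R A" and B: "fgp_module R B"
  shows "FPR R C"
proof -
  note s = short_exactD[OF se]
  obtain \<phi> :: "_ \<Rightarrow> nat \<Rightarrow> 'a" where \<phi>: "inj_on \<phi> (carrier B)"
    using fin_gen_module_inj B by blast
  obtain B' :: "('a, nat \<Rightarrow> 'a) module" and \<psi> where B': "module R B'" "carrier B' = \<phi> ` carrier B"
    "\<phi> \<in> mod_hom R B B'" "\<psi> \<in> mod_hom R B' B"
    "\<And>x. x \<in> carrier B \<Longrightarrow> \<psi> (\<phi> x) = x" "\<And>y. y \<in> carrier B' \<Longrightarrow> \<phi> (\<psi> y) = y"
    using bij_module_copy[OF s(2) \<phi>] by metis
  have fgp: "fgp_module R B'"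
    using B fin_gen_module_copy[OF _ B'(1,3) \<phi> B'(2)] projective_module_copy[OF _ B'(1,3,4,6)]
    by blast
  let ?f = "\<lambda>x. \<phi> (f x)" and ?g = "\<lambda>y. g (\<psi> y)"
  have se': "short_exact R A ?f B' ?g C" by (rule short_exact_copy_mid[OF se B'(1,3-6)])
  note s' = short_exactD[OF se']
  obtain k and Q :: "nat \<Rightarrow> ('a, nat \<Rightarrow> 'a) module" and d e where r: "fgp_resolution R k Q d e A"
    using A by (auto simp: FPR_def)
  have e: "e \<in> mod_hom R (Q 0) A" and sure: "e ` carrier (Q 0) = carrier A"
    using r by (auto simp: fgp_resolution_def right_exact_seq_def)
  \<comment> \<open>\<open>B'\<close> becomes stage 0 and everything in the resolution of
    \<open>A\<close> moves up by one.\<close>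
  define Q' where "Q' = case_nat B' Q"
  define d' where "d' = case_nat (\<lambda>x. ?f (e x)) d"
  have Q': "Q' 0 = B'" "Q' (Suc j) = Q j" and d': "d' 0 = (\<lambda>x. ?f (e x))" "d' (Suc j) = d j" for j
    by (simp_all add: Q'_def d'_def)
  \<comment> \<open>At the joint, \<open>?f\<close> is injective, so composing with it does not
    change the kernel of \<open>e\<close>.\<close>
  have ok: "out_kernel Q' d' ?g C (Suc j) = out_kernel Q d e A j" for j
  proof (cases j)
    case 0
    show ?thesis
      using mod_hom_zero[OF s'(4,1,2)] mod_homD(1)[OF e] s'(6)
      by (auto simp: 0 Q' d' a_kernel_def' mod_hom_inj_on_iff[OF s'(4,1,2)])
  qed (simp add: Q' d')
  have "right_exact_seq R (Suc k) Q' d' ?g C"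
    unfolding right_exact_seq_def
  proof (intro conjI allI impI)
    show "module R C" "?g \<in> mod_hom R (Q' 0) C" "?g ` carrier (Q' 0) = carrier C"
      using s' by (auto simp: Q')
    show "module R (Q' j)" if "j \<le> Suc k" for j
      using that r B'(1) by (cases j) (auto simp: Q' fgp_resolution_def right_exact_seq_def)
    show "d' j \<in> mod_hom R (Q' (Suc j)) (Q' j)" if "j < Suc k" for j
      using that r mod_hom_comp[OF e s'(4)]
      by (cases j) (auto simp: Q' d' fgp_resolution_def right_exact_seq_def)
    show "d' j ` carrier (Q' (Suc j)) = out_kernel Q' d' ?g C j" if "j < Suc k" for j
    proof (cases j)
      case 0
      have "d' 0 ` carrier (Q 0) = ?f ` e ` carrier (Q 0)" by (simp add: d' image_image)
      thus ?thesis using s'(10) sure by (simp add: 0 Q')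
    next
      case (Suc i)
      thus ?thesis using that r
        by (simp add: ok Q' d' fgp_resolution_def right_exact_seq_def del: out_kernel.simps)
    qed
  qed
  moreover have "out_kernel Q' d' ?g C (Suc k) = {\<zero>\<^bsub>Q' (Suc k)\<^esub>}"
    using r unfolding ok by (simp add: Q' fgp_resolution_def)
  moreover have "fgp_module R (Q' j)" if "j \<le> Suc k" for j
    using that r fgp by (cases j) (auto simp: Q' fgp_resolution_def)
  ultimately show ?thesis unfolding FPR_def fgp_resolution_def by blast
qed

section \<open>Syzygies: removing the first module of a resolution\<close>

lemma fgp_resolution_short_exact:
  assumes r: "fgp_resolution R k Q d e M"
  shows "short_exact R (ker_mod (Q 0) M e) (\<lambda>x. x) (Q 0) e M" "fgp_module R (Q 0)"
  using r by (auto simp: fgp_resolution_def right_exact_seq_def intro: short_exact_ker_mod)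

lemma fgp_resolution_0_ker_mod:
  assumes r: "fgp_resolution R 0 Q d e M"
  shows "carrier (ker_mod (Q 0) M e) = {\<zero>\<^bsub>ker_mod (Q 0) M e\<^esub>}"
  using r by (simp add: fgp_resolution_def)

text \<open>The reverse of splicing. Exactness at \<open>Q 0\<close> says that \<open>d 0\<close>
  maps onto the kernel of \<open>e\<close>, so it can serve as the augmentation of the shortened
  resolution.\<close>

lemma fgp_resolution_ker_mod:
  assumes r: "fgp_resolution R (Suc k) Q d e M"
  shows "fgp_resolution R k (\<lambda>j. Q (Suc j)) (\<lambda>j. d (Suc j)) (d 0) (ker_mod (Q 0) M e)"
proof -
  let ?K = "ker_mod (Q 0) M e"
  have ok: "out_kernel (\<lambda>j. Q (Suc j)) (\<lambda>j. d (Suc j)) (d 0) ?K j = out_kernel Q d e M (Suc j)" for j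
    by (cases j) (auto simp: a_kernel_def')
  have im: "d j ` carrier (Q (Suc j)) = out_kernel Q d e M j" if "j < Suc k" for j
    using r that by (simp add: fgp_resolution_def right_exact_seq_def)
  have d0: "d 0 \<in> mod_hom R (Q (Suc 0)) (Q 0)"
    using r by (simp add: fgp_resolution_def right_exact_seq_def)
  have "d 0 \<in> mod_hom R (Q (Suc 0)) ?K"
    using im[of 0] by (intro mod_homI) (auto simp: mod_homD[OF d0])
  thus ?thesis
    using r im[of 0] short_exactD(1)[OF fgp_resolution_short_exact(1)[OF r]]
    by (simp add: fgp_resolution_def right_exact_seq_def ok del: out_kernel.simps(2))
qed

text \<open>Converse of \<open>FPR_step\<close>. Whatever the type of \<open>M\<close>, the modules
  \<open>K\<close> and \<open>P\<close> obtained here live on \<open>nat \<Rightarrow> 'a\<close>.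
  For a resolution of length 0 the kernel is zero.\<close>

lemma FPR_cases:
  fixes M :: "('a, 'b, 'm) module_scheme"
  assumes "FPR R M"
  obtains K P :: "('a, nat \<Rightarrow> 'a) module" and i p
  where "short_exact R K i P p M" "fgp_module R P" "FPR R K"
proof -
  obtain k and Q :: "nat \<Rightarrow> ('a, nat \<Rightarrow> 'a) module" and d e where r: "fgp_resolution R k Q d e M"
    using assms by (auto simp: FPR_def)
  note se = fgp_resolution_short_exact[OF r]
  have "FPR R (ker_mod (Q 0) M e)"
  proof (cases k)
    case 0
    thus ?thesis using r short_exactD(1)[OF se(1)]
      by (intro FPR_fgp zero_module_fgp fgp_resolution_0_ker_mod) auto
  next
    case (Suc k')
    thus ?thesis using fgp_resolution_ker_mod r by (blast intro: FPR_of_fgp_resolution)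
  qed
  with se show thesis by (rule that)
qed

text \<open>Induction on the length of a resolution. \<open>M\<close> is restricted to the carrier
  type of the resolving modules, so that its syzygies have the same type and the predicate
  \<open>X\<close> applies to them.\<close>

lemma FPR_induct [consumes 1, case_names zero step]:
  fixes M :: "('a, nat \<Rightarrow> 'a) module"
  assumes "FPR R M"
    and zero: "\<And>M. module R M \<Longrightarrow> carrier M = {\<zero>\<^bsub>M\<^esub>} \<Longrightarrow> X M"
    and step: "\<And>K i (P :: ('a, nat \<Rightarrow> 'a) module) p M. short_exact R K i P p M \<Longrightarrow> fgp_module R P \<Longrightarrow> FPR R K \<Longrightarrow> X K \<Longrightarrow> X M"
  shows "X M"
proof -
  obtain k and Q :: "nat \<Rightarrow> ('a, nat \<Rightarrow> 'a) module" and d e where "fgp_resolution R k Q d e M"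
    using assms(1) by (auto simp: FPR_def)
  thus ?thesis
  proof (induction k arbitrary: Q d e M)
    case 0
    note se = fgp_resolution_short_exact[OF 0]
    have K: "module R (ker_mod (Q 0) M e)" "carrier (ker_mod (Q 0) M e) = {\<zero>\<^bsub>ker_mod (Q 0) M e\<^esub>}"
      using short_exactD(1)[OF se(1)] fgp_resolution_0_ker_mod[OF 0] .
    \<comment> \<open>A resolution of length 0 is not the base case itself: it is one step above its
      zero kernel.\<close>
    show ?case by (rule step[OF se FPR_fgp[OF zero_module_fgp[OF K]] zero[OF K]])
  next
    case (Suc k)
    note r = fgp_resolution_ker_mod[OF Suc.prems]
    show ?case
      by (rule step[OF fgp_resolution_short_exact[OF Suc.prems] FPR_of_fgp_resolution[OF r] Suc.IH[OF r]])
  qed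
qed

section \<open>Two out of three\<close>

text \<open>The surjections onto \<open>A\<close> and \<open>C\<close> combine to one from
  \<open>P \<oplus> P'\<close> onto \<open>B\<close>, once \<open>p'\<close> is lifted through
  \<open>g\<close>. The kernel \<open>L\<close> of the combined map is then an extension of
  \<open>K'\<close> by \<open>K\<close>.\<close>

lemma horseshoe:
  assumes se: "short_exact R A f B g C"
    and a: "short_exact R K i P p A" and c: "short_exact R K' i' P' p' C"
    and proj: "projective_module R P'"
  obtains L :: "('a, 'p \<times> 'q) module" and q u v
  where "short_exact R L (\<lambda>x. x) (dsum P P') q B" "short_exact R K u L v K'"
proof -
  note s = short_exactD[OF se] and a = short_exactD[OF a] and c = short_exactD[OF c]
  interpret A: module R A by (rule s)
  interpret B: module R B by (rule s)
  interpret C: module R C by (rule s)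
  interpret P: module R P by (rule a)
  interpret P': module R P' by (rule c)
  let ?D = "dsum P P'"
  note D = dsum_module[OF a(2) c(2)]
  obtain h where h: "h \<in> mod_hom R P' B" "\<And>y. y \<in> carrier P' \<Longrightarrow> g (h y) = p' y"
    using projective_module_lift[OF proj s(2,3,5,9) c(5)] by blast
  note fp = mod_hom_comp[OF a(5) s(4)]
  define q where "q = (\<lambda>x. f (p (fst x)) \<oplus>\<^bsub>B\<^esub> h (snd x))"
  have q: "q \<in> mod_hom R ?D B"
    unfolding q_def by (rule mod_hom_dsum[OF fp h(1) a(2) c(2) s(2)])
  have gq: "g (q (x, y)) = p' y" if "x \<in> carrier P" "y \<in> carrier P'" for x y
    using that mod_homD(1)[OF fp] mod_homD(1)[OF h(1)] mod_homD(1)[OF a(5)] mod_homD(1)[OF c(5)]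
    by (simp add: q_def mod_homD(2)[OF s(5)] h(2) s(7))
  have surj: "q ` carrier ?D = carrier B"
  proof (intro equalityI subsetI)
    fix b assume b: "b \<in> carrier B"
    hence "g b \<in> carrier C" by (rule mod_homD(1)[OF s(5)])
    then obtain y where y: "y \<in> carrier P'" "p' y = g b" using c(9) by (metis imageE)
    have hy: "h y \<in> carrier B" using y(1) by (rule mod_homD(1)[OF h(1)])
    \<comment> \<open>Surjectivity of \<open>q\<close>: subtracting the lift \<open>h y\<close> from
      \<open>b\<close> leaves an element of the kernel of \<open>g\<close>, which comes from
      \<open>A\<close> and hence from \<open>P\<close>.\<close>
    have "g (b \<oplus>\<^bsub>B\<^esub> \<ominus>\<^bsub>B\<^esub> h y) = \<zero>\<^bsub>C\<^esub>"
      using b hy y mod_homD(1)[OF s(5)]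
      by (simp add: mod_homD(2)[OF s(5)] mod_hom_minus[OF s(5,2,3)] h(2) C.M.r_neg)
    moreover have "b \<oplus>\<^bsub>B\<^esub> \<ominus>\<^bsub>B\<^esub> h y \<in> carrier B" using b hy by simp
    ultimately obtain z where z: "z \<in> carrier A" "f z = b \<oplus>\<^bsub>B\<^esub> \<ominus>\<^bsub>B\<^esub> h y"
      using s(8) by (metis imageE)
    then obtain x where x: "x \<in> carrier P" "p x = z" using a(9) by (metis imageE)
    have "q (x, y) = b"
      using b hy z(2) by (simp add: q_def x(2) B.M.a_assoc B.M.l_neg)
    thus "b \<in> q ` carrier ?D" using x(1) y(1) by (metis (no_types) image_eqI dsum_simps(1) SigmaI)
  qed (use mod_homD(1)[OF q] in auto)
  define L where "L = ker_mod ?D B q"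
  have seL: "short_exact R L (\<lambda>x. x) ?D q B"
    unfolding L_def by (rule short_exact_ker_mod[OF q D s(2) surj])
  have L: "module R L" using seL by (rule short_exactD)
  have cL: "(x, y) \<in> carrier L \<longleftrightarrow> x \<in> carrier P \<and> y \<in> carrier P' \<and> q (x, y) = \<zero>\<^bsub>B\<^esub>" for x y
    by (auto simp: L_def a_kernel_def')
  have sndL: "snd \<in> mod_hom R L P'"
    using mod_hom_comp[OF short_exactD(4)[OF seL] dsum_homs(4)[OF a(2) c(2)]] by simp
  \<comment> \<open>On \<open>L\<close> the map \<open>q\<close> vanishes, so \<open>gq\<close> puts
    the second component in the kernel of \<open>p'\<close>. Factoring \<open>snd\<close> through
    \<open>i'\<close> yields \<open>v\<close>.\<close>
  have "snd x \<in> i' ` carrier K'" if xL: "x \<in> carrier L" for x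
  proof (rule c(8))
    obtain x1 x2 where x: "x = (x1, x2)" "x1 \<in> carrier P" "x2 \<in> carrier P'" "q (x1, x2) = \<zero>\<^bsub>B\<^esub>"
      using xL cL by (cases x) auto
    show "snd x \<in> carrier P'" using x by simp
    show "p' (snd x) = \<zero>\<^bsub>C\<^esub>" using gq[OF x(2,3)] x mod_hom_zero[OF s(5,2,3)] by simp
  qed
  then obtain v where v: "v \<in> mod_hom R L K'" "\<And>x. x \<in> carrier L \<Longrightarrow> i' (v x) = snd x"
    using mod_hom_factor[OF c(4,6) sndL _ c(1)] by blast
  let ?u = "\<lambda>k. (i k, \<zero>\<^bsub>P'\<^esub>)"
  note iD = mod_hom_comp[OF a(4) dsum_homs(1)[OF a(2) c(2)]]
  have qu: "q (x, \<zero>\<^bsub>P'\<^esub>) = f (p x)" if "x \<in> carrier P" for x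
    using that mod_homD(1)[OF fp] by (simp add: q_def mod_hom_zero[OF h(1) c(2) s(2)])
  have uL: "?u k \<in> carrier L" if "k \<in> carrier K" for k
    using that mod_homD(1)[OF a(4)] qu[of "i k"]
    by (simp add: cL a(7) mod_hom_zero[OF s(4,1,2)])
  have u: "?u \<in> mod_hom R K L"
    using uL mod_homD(2,3)[OF iD] by (intro mod_homI) (simp_all add: L_def)
  have i'0: "i' z = \<zero>\<^bsub>P'\<^esub> \<longleftrightarrow> z = \<zero>\<^bsub>K'\<^esub>" if "z \<in> carrier K'" for z
    using that c(6) mod_hom_inj_on_iff[OF c(4,1,2)] mod_hom_zero[OF c(4,1,2)] by auto
  have "short_exact R K ?u L v K'"
  proof (rule short_exactI[OF a(1) L c(1) u v(1)])
    fix k assume "k \<in> carrier K" "?u k = \<zero>\<^bsub>L\<^esub>"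
    thus "k = \<zero>\<^bsub>K\<^esub>" using a(6) mod_hom_inj_on_iff[OF a(4,1,2)] by (auto simp: L_def)
  next
    fix k assume k: "k \<in> carrier K"
    show "v (?u k) = \<zero>\<^bsub>K'\<^esub>"
      using v(2)[OF uL[OF k]] i'0[OF mod_homD(1)[OF v(1) uL[OF k]]] by simp
  next
    fix x assume x: "x \<in> carrier L" "v x = \<zero>\<^bsub>K'\<^esub>"
    obtain x1 x2 where x12: "x = (x1, x2)" by (cases x)
    \<comment> \<open>If \<open>v x\<close> is zero then so is the second component, and
      \<open>q\<close> reduces to \<open>f\<close> after \<open>p\<close> on the first one.
      Injectivity of \<open>f\<close> then puts that component in the kernel of
      \<open>p\<close>.\<close>
    have x2: "x2 = \<zero>\<^bsub>P'\<^esub>" using v(2)[OF x(1)] x(2) mod_hom_zero[OF c(4,1,2)] x12 by simp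
    have x1: "x1 \<in> carrier P" "f (p x1) = \<zero>\<^bsub>B\<^esub>" using x(1) x12 x2 cL qu by auto
    hence "p x1 = \<zero>\<^bsub>A\<^esub>"
      using s(6) mod_hom_inj_on_iff[OF s(4,1,2)] mod_homD(1)[OF a(5)] by blast
    thus "x \<in> ?u ` carrier K" using a(8)[OF x1(1)] x12 x2 by auto
  next
    fix z assume z: "z \<in> carrier K'"
    have iz: "i' z \<in> carrier P'" using z by (rule mod_homD(1)[OF c(4)])
    have hz: "h (i' z) \<in> carrier B" using iz by (rule mod_homD(1)[OF h(1)])
    \<comment> \<open>To complete \<open>i' z\<close> to an element of \<open>L\<close>, the first
      component must cancel \<open>h (i' z)\<close> under \<open>q\<close>. The negative of this
      element lies in the kernel of \<open>g\<close>, so it is reached from \<open>P\<close> through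
      \<open>A\<close>.\<close>
    have "g (\<ominus>\<^bsub>B\<^esub> h (i' z)) = \<zero>\<^bsub>C\<^esub>"
      using hz iz z by (simp add: mod_hom_minus[OF s(5,2,3)] h(2) c(7))
    then obtain y where y: "y \<in> carrier A" "f y = \<ominus>\<^bsub>B\<^esub> h (i' z)"
      using s(8)[OF B.M.a_inv_closed[OF hz]] by (metis imageE)
    then obtain x where x: "x \<in> carrier P" "p x = y" using a(9) by (metis imageE)
    have xL: "(x, i' z) \<in> carrier L"
      using x y iz hz by (simp add: cL q_def B.M.l_neg)
    have "v (x, i' z) = z"
      using v(2)[OF xL] inj_onD[OF c(6) _ mod_homD(1)[OF v(1) xL] z] by simp
    thus "z \<in> v ` carrier L" using xL by (metis image_eqI)
  qed
  with seL show thesis by (rule that)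
qed

text \<open>Even positions store the first function and odd ones the second. This allows a module
  inside a direct sum to be copied back to functions on \<open>nat\<close>, for any
  \<open>'a\<close>.\<close>

lemma inj_interleave: "inj (\<lambda>(u, v) k :: nat. if even k then u (k div 2) else v (k div 2))"
proof (rule injI)
  fix x y :: "(nat \<Rightarrow> 'a) \<times> (nat \<Rightarrow> 'a)"
  assume eq: "(case x of (u, v) \<Rightarrow> \<lambda>k. if even k then u (k div 2) else v (k div 2)) =
    (case y of (u, v) \<Rightarrow> \<lambda>k. if even k then u (k div 2) else v (k div 2))"
  have "fst x k = fst y k" "snd x k = snd y k" for k
    using fun_cong[OF eq, of "2 * k"] fun_cong[OF eq, of "Suc (2 * k)"] by (simp_all add: split_beta)
  thus "x = y" by (auto simp: prod_eq_iff)
qed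

lemma fgp_dsum: "fgp_module R P \<Longrightarrow> fgp_module R Q \<Longrightarrow> fgp_module R (dsum P Q)"
  by (simp add: dsum_fin_gen dsum_projective)

text \<open>
  HOL induction cannot change types. The extension of \<open>K'\<close> by \<open>K\<close> inside a direct sum is
  therefore moved back to the carrier type \<open>nat \<Rightarrow> 'a\<close>.
\<close>

lemma FPR_extension_reduce:
  fixes A :: "('a, 'b, 'm) module_scheme" and K' P' :: "('a, nat \<Rightarrow> 'a) module"
  assumes se: "short_exact R A f B g C" and A: "FPR R A"
    and C: "short_exact R K' i' P' p' C" "fgp_module R P'"
  obtains K L :: "('a, nat \<Rightarrow> 'a) module" and u v
  where "FPR R K" "short_exact R K u L v K'" "FPR R L \<longrightarrow> FPR R B"
proof -
  obtain K P :: "('a, nat \<Rightarrow> 'a) module" and i p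
    where A: "short_exact R K i P p A" "fgp_module R P" "FPR R K"
    using FPR_cases[OF A] .
  obtain L :: "('a, (nat \<Rightarrow> 'a) \<times> (nat \<Rightarrow> 'a)) module" and q u v where
    L: "short_exact R L (\<lambda>x. x) (dsum P P') q B" "short_exact R K u L v K'"
    using horseshoe[OF se A(1) C(1) conjunct2[OF C(2)]] .
  obtain \<phi> :: "(nat \<Rightarrow> 'a) \<times> (nat \<Rightarrow> 'a) \<Rightarrow> nat \<Rightarrow> 'a" where "inj \<phi>"
    using inj_interleave by blast
  hence "inj_on \<phi> (carrier L)" by (rule inj_on_subset) simp
  then obtain L' :: "('a, nat \<Rightarrow> 'a) module" and \<psi> where L': "module R L'"
    "carrier L' = \<phi> ` carrier L" "\<phi> \<in> mod_hom R L L'" "\<psi> \<in> mod_hom R L' L"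
    "\<And>x. x \<in> carrier L \<Longrightarrow> \<psi> (\<phi> x) = x" "\<And>y. y \<in> carrier L' \<Longrightarrow> \<phi> (\<psi> y) = y"
    using bij_module_copy[OF short_exactD(2)[OF L(2)]] by metis
  have "FPR R L' \<longrightarrow> FPR R B"
  proof
    assume "FPR R L'"
    moreover have "inj_on \<psi> (carrier L')" using L'(6) by (rule inj_on_inverseI)
    moreover have "\<psi> ` carrier L' = carrier L" using L'(5) by (simp add: L'(2) image_image)
    ultimately have "FPR R L" using FPR_iso[OF _ short_exactD(2)[OF L(2)] L'(4)] by blast
    \<comment> \<open>\<open>L\<close> is the kernel of the surjection from the finitely generated
      projective \<open>dsum P P'\<close> onto \<open>B\<close>.\<close>
    thus "FPR R B" using FPR_step[OF L(1)] fgp_dsum[OF A(2) C(2)] by blast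
  qed
  with A(3) short_exact_copy_mid[OF L(2) L'(1,3-6)] show thesis by (rule that)
qed

text \<open>Each step replaces \<open>C\<close> by its syzygy \<open>K'\<close>, and at the same
  time \<open>A\<close> and \<open>B\<close> by \<open>K\<close> and \<open>L\<close>, which is why
  these vary in the induction. When \<open>C\<close> is zero, \<open>f\<close> is an
  isomorphism.\<close>

lemma FPR_extension_nat_fun:
  fixes A B C :: "('a, nat \<Rightarrow> 'a) module"
  assumes "FPR R C" and "FPR R A" and "short_exact R A f B g C"
  shows "FPR R B"
  using assms
proof (induction C arbitrary: A f B g rule: FPR_induct)
  case (zero C)
  note s = short_exactD[OF zero(4)]
  have "f ` carrier A = carrier B"
    using mod_homD(1)[OF s(4)] mod_homD(1)[OF s(5)] s(8) zero(2) by blast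
  thus ?case using FPR_iso[OF zero(3) s(2,4,6)] by blast
next
  case (step K' i' P' p' C)
  obtain K L :: "('a, nat \<Rightarrow> 'a) module" and u v
    where "FPR R K" "short_exact R K u L v K'" "FPR R L \<longrightarrow> FPR R B"
    using FPR_extension_reduce[OF step.prems(2,1) step.hyps(1,2)] .
  thus ?case using step.IH by blast
qed

text \<open>One reduction step suffices to leave arbitrary types: \<open>K\<close>, \<open>L\<close>
  and \<open>K'\<close> all live on \<open>nat \<Rightarrow> 'a\<close>, where the induction
  applies.\<close>

lemma FPR_extension:
  assumes se: "short_exact R A f B g C" and A: "FPR R A" and C: "FPR R C"
  shows "FPR R B"
proof -
  obtain K' P' :: "('a, nat \<Rightarrow> 'a) module" and i' p'
    where C: "short_exact R K' i' P' p' C" "fgp_module R P'" "FPR R K'"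
    using FPR_cases[OF C] .
  obtain K L :: "('a, nat \<Rightarrow> 'a) module" and u v
    where "FPR R K" "short_exact R K u L v K'" "FPR R L \<longrightarrow> FPR R B"
    using FPR_extension_reduce[OF se A C(1,2)] .
  thus ?thesis using FPR_extension_nat_fun[OF C(3)] by blast
qed

text \<open>The kernel \<open>L\<close> of \<open>P \<rightarrow> C\<close> is the preimage under
  \<open>p\<close> of the image of \<open>A\<close>. It contains the image of \<open>K\<close>, with
  quotient \<open>A\<close>, so it is in the class by closure under extensions.\<close>

lemma FPR_quotient:
  assumes se: "short_exact R A f B g C" and A: "FPR R A" and B: "FPR R B"
  shows "FPR R C"
proof -
  note s = short_exactD[OF se]
  obtain K P :: "('a, nat \<Rightarrow> 'a) module" and i p
    where B: "short_exact R K i P p B" "fgp_module R P" "FPR R K"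
    using FPR_cases[OF B] .
  note b = short_exactD[OF B(1)]
  let ?q = "\<lambda>x. g (p x)"
  have q: "?q \<in> mod_hom R P C" by (rule mod_hom_comp[OF b(5) s(5)])
  have "?q ` carrier P = g ` p ` carrier P" by (simp add: image_image)
  hence surj: "?q ` carrier P = carrier C" using b(9) s(9) by simp
  define L where "L = ker_mod P C ?q"
  have seL: "short_exact R L (\<lambda>x. x) P ?q C"
    unfolding L_def by (rule short_exact_ker_mod[OF q b(2) s(3) surj])
  note l = short_exactD[OF seL]
  have cL: "x \<in> carrier L \<longleftrightarrow> x \<in> carrier P \<and> g (p x) = \<zero>\<^bsub>C\<^esub>" for x
    by (auto simp: L_def a_kernel_def')
  have pL: "p \<in> mod_hom R L B" using mod_hom_comp[OF l(4) b(5)] by simp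
  \<comment> \<open>Exactness at \<open>B\<close> turns the condition defining \<open>L\<close> into
    membership in the image of \<open>f\<close>, so \<open>p\<close> restricted to \<open>L\<close>
    factors through \<open>A\<close>.\<close>
  have "p x \<in> f ` carrier A" if "x \<in> carrier L" for x
    using that s(8) mod_homD(1)[OF b(5)] by (simp add: cL)
  then obtain v where v: "v \<in> mod_hom R L A" "\<And>x. x \<in> carrier L \<Longrightarrow> f (v x) = p x"
    using mod_hom_factor[OF s(4,6) pL _ s(1)] by blast
  have iL: "i k \<in> carrier L" if "k \<in> carrier K" for k
    using that mod_homD(1)[OF b(4)] by (simp add: cL b(7) mod_hom_zero[OF s(5,2,3)])
  have i: "i \<in> mod_hom R K L"
    using iL mod_homD(2,3)[OF b(4)] by (intro mod_homI) (simp_all add: L_def)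
  have f0: "f x = \<zero>\<^bsub>B\<^esub> \<longleftrightarrow> x = \<zero>\<^bsub>A\<^esub>" if "x \<in> carrier A" for x
    using that s(6) mod_hom_inj_on_iff[OF s(4,1,2)] mod_hom_zero[OF s(4,1,2)] by auto
  have "short_exact R K i L v A"
  proof (rule short_exactI[OF b(1) l(1) s(1) i v(1)])
    fix k assume "k \<in> carrier K" "i k = \<zero>\<^bsub>L\<^esub>"
    thus "k = \<zero>\<^bsub>K\<^esub>" using b(6) mod_hom_inj_on_iff[OF b(4,1,2)] by (auto simp: L_def)
  next
    fix k assume k: "k \<in> carrier K"
    show "v (i k) = \<zero>\<^bsub>A\<^esub>"
      using v(2)[OF iL[OF k]] b(7)[OF k] f0[OF mod_homD(1)[OF v(1) iL[OF k]]] by simp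
  next
    fix x assume x: "x \<in> carrier L" "v x = \<zero>\<^bsub>A\<^esub>"
    hence "p x = \<zero>\<^bsub>B\<^esub>" using v(2)[OF x(1)] mod_hom_zero[OF s(4,1,2)] by simp
    thus "x \<in> i ` carrier K" using x(1) b(8) by (simp add: cL)
  next
    fix a assume a: "a \<in> carrier A"
    hence "f a \<in> carrier B" by (rule mod_homD(1)[OF s(4)])
    then obtain x where x: "x \<in> carrier P" "p x = f a" using b(9) by (metis imageE)
    hence xL: "x \<in> carrier L" using s(7)[OF a] by (simp add: cL)
    have "v x = a"
      using v(2)[OF xL] x(2) inj_onD[OF s(6) _ mod_homD(1)[OF v(1) xL] a] by simp
    thus "a \<in> v ` carrier L" using xL by blast
  qed
  hence "FPR R L" using B(3) A by (rule FPR_extension)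
  with seL show ?thesis using B(2) by (rule FPR_step)
qed

text \<open>
  If \<open>0 \<rightarrow> K \<rightarrow> P \<rightarrow> C \<rightarrow> 0\<close> is the start of a resolution of \<open>C\<close>, a lift \<open>h\<close> of \<open>P \<rightarrow> C\<close> to \<open>B\<close> gives
  a short exact sequence \<open>0 \<rightarrow> K \<rightarrow> A \<oplus> P \<rightarrow> B \<rightarrow> 0\<close>; then \<open>A\<close> is the quotient of \<open>A \<oplus> P\<close> by \<open>P\<close>.
\<close>

lemma FPR_kernel:
  assumes se: "short_exact R A f B g C" and B: "FPR R B" and C: "FPR R C"
  shows "FPR R A"
proof -
  note s = short_exactD[OF se]
  obtain K P :: "('a, nat \<Rightarrow> 'a) module" and i p
    where C: "short_exact R K i P p C" "fgp_module R P" "FPR R K"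
    using FPR_cases[OF C] .
  note c = short_exactD[OF C(1)]
  interpret A: module R A by (rule s)
  interpret B: module R B by (rule s)
  interpret C: module R C by (rule s)
  interpret P: module R P by (rule c)
  let ?D = "dsum A P"
  note D = dsum_module[OF s(1) c(2)]
  obtain h where h: "h \<in> mod_hom R P B" "\<And>y. y \<in> carrier P \<Longrightarrow> g (h y) = p y"
    using projective_module_lift[OF _ s(2,3,5,9) c(5)] C(2) by blast
  let ?q = "\<lambda>x. f (fst x) \<oplus>\<^bsub>B\<^esub> h (snd x)"
  have q: "?q \<in> mod_hom R ?D B" by (rule mod_hom_dsum[OF s(4) h(1) s(1) c(2) s(2)])
  have hi: "(\<lambda>k. h (i k)) \<in> mod_hom R K B" by (rule mod_hom_comp[OF c(4) h(1)])
  \<comment> \<open>Applying \<open>g\<close> gives \<open>p (i k)\<close>, which is zero. Hence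
    \<open>h\<close> after \<open>i\<close> factors through \<open>f\<close>, and the factor
    \<open>w\<close> measures how far \<open>h\<close> is from vanishing on
    \<open>K\<close>.\<close>
  have "h (i k) \<in> f ` carrier A" if "k \<in> carrier K" for k
    using that mod_homD(1)[OF hi] mod_homD(1)[OF c(4)] by (intro s(8)) (simp_all add: h(2) c(7))
  then obtain w where w: "w \<in> mod_hom R K A" "\<And>k. k \<in> carrier K \<Longrightarrow> f (w k) = h (i k)"
    using mod_hom_factor[OF s(4,6) hi _ s(1)] by blast
  \<comment> \<open>The sign makes the two contributions to \<open>?q\<close> cancel.\<close>
  let ?j = "\<lambda>k. (\<ominus>\<^bsub>A\<^esub> w k, i k)"
  have j: "?j \<in> mod_hom R K ?D"
    by (rule mod_homI)
      (simp_all add: mod_homD[OF w(1)] mod_homD[OF c(4)] A.M.minus_add A.smult_r_minus)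
  have "short_exact R K ?j ?D ?q B"
  proof (rule short_exactI[OF c(1) D s(2) j q])
    fix k assume "k \<in> carrier K" "?j k = \<zero>\<^bsub>?D\<^esub>"
    thus "k = \<zero>\<^bsub>K\<^esub>" using c(6) mod_hom_inj_on_iff[OF c(4,1,2)] by auto
  next
    fix k assume k: "k \<in> carrier K"
    show "?q (?j k) = \<zero>\<^bsub>B\<^esub>"
      using k mod_homD(1)[OF w(1) k] mod_homD(1)[OF hi k]
      by (simp add: mod_hom_minus[OF s(4,1,2)] w(2) B.M.l_neg)
  next
    fix x assume x: "x \<in> carrier ?D" "?q x = \<zero>\<^bsub>B\<^esub>"
    obtain a y where ay: "x = (a, y)" "a \<in> carrier A" "y \<in> carrier P" using x(1) by auto
    have fa: "f a \<in> carrier B" and hy: "h y \<in> carrier B"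
      using mod_homD(1)[OF s(4) ay(2)] mod_homD(1)[OF h(1) ay(3)] .
    have eq: "f a \<oplus>\<^bsub>B\<^esub> h y = \<zero>\<^bsub>B\<^esub>" using x(2) ay(1) by simp
    \<comment> \<open>Applying \<open>g\<close> to the relation removes \<open>f a\<close> and shows
      that \<open>y\<close> comes from some \<open>k\<close> in \<open>K\<close>. Then
      \<open>f\<close> sends both \<open>a\<close> and the negative of \<open>w k\<close> to the
      negative of \<open>h y\<close>.\<close>
    have "g (f a \<oplus>\<^bsub>B\<^esub> h y) = p y"
      using fa hy mod_homD(1)[OF c(5) ay(3)]
      by (simp add: mod_homD(2)[OF s(5)] s(7)[OF ay(2)] h(2)[OF ay(3)])
    hence "p y = \<zero>\<^bsub>C\<^esub>" unfolding eq by (simp add: mod_hom_zero[OF s(5,2,3)])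
    then obtain k where k: "k \<in> carrier K" "y = i k" using c(8)[OF ay(3)] by blast
    have "f (\<ominus>\<^bsub>A\<^esub> w k) = \<ominus>\<^bsub>B\<^esub> h y"
      using k mod_homD(1)[OF w(1) k(1)] by (simp add: mod_hom_minus[OF s(4,1,2)] w(2))
    also have "\<dots> = f a" using B.M.minus_equality[OF eq hy fa] .
    finally have "\<ominus>\<^bsub>A\<^esub> w k = a"
      using inj_onD[OF s(6)] mod_homD(1)[OF w(1) k(1)] ay(2) by blast
    thus "x \<in> ?j ` carrier K" using k ay(1) by blast
  next
    fix b assume b: "b \<in> carrier B"
    hence "g b \<in> carrier C" by (rule mod_homD(1)[OF s(5)])
    then obtain y where y: "y \<in> carrier P" "p y = g b" using c(9) by (metis imageE)
    have hy: "h y \<in> carrier B" using y(1) by (rule mod_homD(1)[OF h(1)])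
    have "g (b \<oplus>\<^bsub>B\<^esub> \<ominus>\<^bsub>B\<^esub> h y) = \<zero>\<^bsub>C\<^esub>"
      using b hy y mod_homD(1)[OF s(5)]
      by (simp add: mod_homD(2)[OF s(5)] mod_hom_minus[OF s(5,2,3)] h(2) C.M.r_neg)
    moreover have "b \<oplus>\<^bsub>B\<^esub> \<ominus>\<^bsub>B\<^esub> h y \<in> carrier B" using b hy by simp
    ultimately obtain a where a: "a \<in> carrier A" "f a = b \<oplus>\<^bsub>B\<^esub> \<ominus>\<^bsub>B\<^esub> h y"
      using s(8) by (metis imageE)
    have "b = ?q (a, y)" using b hy a(2) by (simp add: B.M.a_assoc B.M.l_neg)
    thus "b \<in> ?q ` carrier ?D" using a(1) y(1) by (intro image_eqI) auto
  qed
  hence "FPR R ?D" using C(3) B by (rule FPR_extension)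
  moreover have "short_exact R P (\<lambda>y. (\<zero>\<^bsub>A\<^esub>, y)) ?D fst A"
    by (rule short_exactI[OF c(2) D s(1) dsum_homs(2)[OF s(1) c(2)] dsum_homs(3)[OF s(1) c(2)]])
      (auto intro: rev_image_eqI)
  ultimately show ?thesis using FPR_quotient FPR_fgp[OF C(2)] by blast
qed

section \<open>Long exact sequences\<close>

lemma FPR_iff_FPR_kernel:
  assumes "short_exact R A f B g C" and "FPR R B"
  shows "FPR R A \<longleftrightarrow> FPR R C"
  using assms FPR_quotient FPR_kernel by blast

text \<open>Induction along the syzygies: consecutive ones are the ends of a short exact sequence
  with middle term \<open>P j\<close>, so membership passes from each to the next. That each syzygy
  is a module is carried along, since the next short exact sequence needs it.\<close>

lemma FPR_out_kernel_iff:
  assumes r: "right_exact_seq R n P d e M" and P: "\<And>j. j \<le> n \<Longrightarrow> FPR R (P j)" and "j \<le> n"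
  shows "module R (P j\<lparr>carrier := out_kernel P d e M j\<rparr>) \<and>
    (FPR R (P j\<lparr>carrier := out_kernel P d e M j\<rparr>) \<longleftrightarrow> FPR R M)"
  using \<open>j \<le> n\<close>
proof (induction j)
  case 0
  have "short_exact R (ker_mod (P 0) M e) (\<lambda>x. x) (P 0) e M"
    using r by (intro short_exact_ker_mod) (auto simp: right_exact_seq_def)
  thus ?case using FPR_iff_FPR_kernel P short_exactD(1) by fastforce
next
  case (Suc j)
  let ?K = "P j\<lparr>carrier := out_kernel P d e M j\<rparr>"
  have K: "module R ?K" "FPR R ?K \<longleftrightarrow> FPR R M" using Suc by auto
  have d: "d j \<in> mod_hom R (P (Suc j)) (P j)" and PS: "module R (P (Suc j))"
    and im: "d j ` carrier (P (Suc j)) = out_kernel P d e M j"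
    using r Suc.prems by (simp_all add: right_exact_seq_def)
  \<comment> \<open>The differential is regarded as a surjection onto the previous syzygy. Its
    kernel stays the same because \<open>?K\<close> has the zero of \<open>P j\<close>.\<close>
  have "d j \<in> mod_hom R (P (Suc j)) ?K"
    using im by (intro mod_homI) (auto simp: mod_homD[OF d])
  hence "short_exact R (ker_mod (P (Suc j)) ?K (d j)) (\<lambda>x. x) (P (Suc j)) (d j) ?K"
    using PS K(1) im by (intro short_exact_ker_mod) auto
  moreover have "a_kernel (P (Suc j)) ?K (d j) = out_kernel P d e M (Suc j)"
    by (simp add: a_kernel_def')
  ultimately have "short_exact R (P (Suc j)\<lparr>carrier := out_kernel P d e M (Suc j)\<rparr>)
      (\<lambda>x. x) (P (Suc j)) (d j) ?K"
    by (simp only:)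
  thus ?case using FPR_iff_FPR_kernel P[OF Suc.prems] short_exactD(1) K(2) by blast
qed

text \<open>\<open>i\<close> identifies \<open>K\<close> with the last syzygy, to which the
  preceding lemma applies.\<close>

lemma FPR_long_exact_iff:
  assumes l: "long_exact R K i n P d e M" and P: "\<And>j. j \<le> n \<Longrightarrow> FPR R (P j)"
  shows "FPR R M \<longleftrightarrow> FPR R K"
proof -
  let ?K = "P n\<lparr>carrier := out_kernel P d e M n\<rparr>"
  have r: "right_exact_seq R n P d e M" and K: "module R K" and i: "i \<in> mod_hom R K (P n)"
    and ker: "a_kernel K (P n) i = {\<zero>\<^bsub>K\<^esub>}" and im: "i ` carrier K = out_kernel P d e M n"
    using l by (simp_all add: long_exact_def)
  have Pn: "module R (P n)" using r by (simp add: right_exact_seq_def)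
  have K': "module R ?K" "FPR R ?K \<longleftrightarrow> FPR R M"
    using FPR_out_kernel_iff[OF r P order_refl] by auto
  have i': "i \<in> mod_hom R K ?K"
    using im by (intro mod_homI) (auto simp: mod_homD[OF i])
  have inj: "inj_on i (carrier K)"
    unfolding mod_hom_inj_on_iff[OF i K Pn] using ker by (auto simp: a_kernel_def')
  \<comment> \<open>The inverse of \<open>i\<close> is obtained by factoring the identity of
    \<open>?K\<close> through \<open>i\<close>.\<close>
  obtain v where v: "v \<in> mod_hom R ?K K" "\<And>x. x \<in> carrier ?K \<Longrightarrow> i (v x) = x"
  proof (rule mod_hom_factor[OF i' inj _ _ K])
    show "(\<lambda>x. x) \<in> mod_hom R ?K ?K" by (simp add: mod_hom_def)
  qed (use im in auto)
  have "v (i x) = x" if "x \<in> carrier K" for x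
    by (rule inj_onD[OF inj v(2)[OF mod_homD(1)[OF i' that]]
        mod_homD(1)[OF v(1) mod_homD(1)[OF i' that]] that])
  moreover have "carrier ?K = i ` carrier K" using im by simp
  ultimately have "v ` carrier ?K = carrier K" by (simp add: image_image)
  moreover have "inj_on v (carrier ?K)" using v(2) by (rule inj_on_inverseI)
  ultimately have "FPR R ?K \<Longrightarrow> FPR R K" using FPR_iso[OF _ K v(1)] by blast
  moreover have "FPR R K \<Longrightarrow> FPR R ?K" using FPR_iso[OF _ K'(1) i' inj] im by simp
  ultimately show ?thesis using K'(2) by blast
qed

theorem lemma2p2:
  fixes R :: "('a, 'r) ring_scheme"
    and A :: "('a, 'b1, 'm1) module_scheme"
    and B :: "('a, 'b2, 'm2) module_scheme"
    and C :: "('a, 'b3, 'm3) module_scheme"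
    and f :: "'b1 \<Rightarrow> 'b2" and g :: "'b2 \<Rightarrow> 'b3"
    and K :: "('a, 'k, 'm4) module_scheme"
    and P :: "nat \<Rightarrow> ('a, 'p, 'm5) module_scheme"
    and M :: "('a, 'c, 'm6) module_scheme"
    and n :: nat
    and i :: "'k \<Rightarrow> 'p" and d :: "nat \<Rightarrow> 'p \<Rightarrow> 'p" and e :: "'p \<Rightarrow> 'c"
  assumes "cring R"
  shows "(short_exact R A f B g C \<longrightarrow>
            (fin_gen_module R B \<and> projective_module R B \<longrightarrow> (FPR R A \<longleftrightarrow> FPR R C)) \<and>
            (FPR R A \<and> FPR R C \<longrightarrow> FPR R B) \<and>
            (FPR R A \<and> FPR R B \<longrightarrow> FPR R C) \<and>
            (FPR R B \<and> FPR R C \<longrightarrow> FPR R A)) \<and>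
         (long_exact R K i n P d e M \<and> (\<forall>j\<le>n. FPR R (P j)) \<longrightarrow>
            (FPR R M \<longleftrightarrow> FPR R K))"
proof (intro conjI impI)
  assume se: "short_exact R A f B g C"
  show "FPR R A \<longleftrightarrow> FPR R C" if "fgp_module R B"
    by (rule FPR_iff_FPR_kernel[OF se FPR_fgp[OF that]])
  show "FPR R B" if "FPR R A \<and> FPR R C" using FPR_extension[OF se] that by blast
  show "FPR R C" if "FPR R A \<and> FPR R B" using FPR_quotient[OF se] that by blast
  show "FPR R A" if "FPR R B \<and> FPR R C" using FPR_kernel[OF se] that by blast
next
  assume "long_exact R K i n P d e M \<and> (\<forall>j\<le>n. FPR R (P j))"
  thus "FPR R M \<longleftrightarrow> FPR R K" using FPR_long_exact_iff by blast
qed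

end
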